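(* Let $\boldsymbol p=(p,\dots,p)$ be a dimension tuple of size $d$, and let $c\in\mathbb{R}^{\boldsymbol p}\setminus\{0\}$ correspond to a homogeneous polynomial of degree $g$, where $g+1=p$ (i.e. $Lc=gc$, with $L$ the degree operator), with variable locality $K_{\mathrm{loc}}$. Then the block sizes $\rho_{k,\tilde g}=|\mathcal{S}_{k,\tilde g}|$ of the block-sparse tensor train representation of $c$ are bounded by $$\rho_{k,\tilde g}\;\le\;\sum_{\ell=1}^{K_{\mathrm{loc}}}\min\left\{\binom{K_{\mathrm{loc}}-\ell+1+\tilde g-2}{K_{\mathrm{loc}}-\ell},\ \binom{\ell+g-\tilde g-2}{\ell-1}\right\}$$ for all $k=1,\dots,d-1$ and $\tilde g=1,\dots,g-1$, and moreover $\rho_{k,0}=\rho_{k,g}=1$.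
   Context: **Tensors and polynomials.** $\mathbb{R}^{\boldsymbol p}=\mathbb{R}^{p\times\cdots\times p}$ is the space of real tensors of order $d$ whose indices run over $\{1,\dots,p\}$. With the monomial dictionary $\Psi(x)=(1,x,\dots,x^{p-1})^T$, a tensor $c\in\mathbb{R}^{\boldsymbol p}$ corresponds to the polynomial $u(x_1,\dots,x_d)=\sum_{m_1,\dots,m_d=1}^p c(m_1,\dots,m_d)\prod_{k=1}^d x_k^{m_k-1}$. **Degree operator.** Let $I_p$ be the $p\times p$ identity and $N=\mathrm{diag}(0,1,\dots,p-1)$. Then $$L=\sum_{k=1}^d I_p^{\otimes(k-1)}\otimes N\otimes I_p^{\otimes(d-k)}.$$ The condition $Lc=gc$ means that $c(m_1,\dots,m_d)=0$ whenever $\sum_k m_k\ne d+g$, i.e. $u$ is homogeneous of degree $g$. The partial operators are $$L^{\le}_k=\sum_{m=1}^k I_p^{\otimes(m-1)}\otimes N\otimes I_p^{\otimes(k-m)},\qquad L^{\ge}_{k+1}=\sum_{m=k+1}^d I_p^{\otimes(m-k-1)}\otimes N\otimes I_p^{\otimes(d-m)},$$ acting on tensors in the first $k$ and the last $d-k$ indices, respectively. **Variable locality.** The homogeneous polynomial $u$ of degree $g$ can be written as $u(x)=\sum_{n_1,\dots,n_g=1}^d B(n_1,\dots,n_g)\,x_{n_1}\cdots x_{n_g}$ with a symmetric tensor $B$ of order $g$, given by $$B(n_1,\dots,n_g)=\binom{g}{m_1-1,\dots,m_d-1}^{-1}c(m_1,\dots,m_d),\qquad m_k=1+\sum_{\ell=1}^g\delta_{k,n_\ell}.$$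 The polynomial has variable locality $K_{\mathrm{loc}}$ (a nonnegative integer) if $B(\ell_1,\dots,\ell_g)=0$ for all $(\ell_1,\dots,\ell_g)\in\{1,\dots,d\}^g$ with $\max\{|\ell_{m_1}-\ell_{m_2}|: m_1,m_2=1,\dots,g\}>K_{\mathrm{loc}}$. **Tensor trains.** A tensor train of rank $(r_1,\dots,r_{d-1})$ represents $c$ by component tensors $C_k\in\mathbb{R}^{r_{k-1}\times p\times r_k}$, $k=1,\dots,d$, $r_0=r_d=1$, through $$c(i_1,\dots,i_d)=\sum_{j_1,\dots,j_{d-1}}C_1(i_1,j_1)\,C_2(j_1,i_2,j_2)\cdots C_d(j_{d-1},i_d).$$ For $\ell=1,\dots,r_k$, the left interface vector is $\tau^{\le}_{k,\ell}(c)(i_1,\dots,i_k)=\sum_{j_1,\dots,j_{k-1}}C_1(i_1,j_1)\cdots C_k(j_{k-1},i_k,\ell)$, where the tensor train is assumed left orthogonal (for each of $C_1,\dots,C_{d-1}$, contracting the component with itself over all indices but the last gives the identity matrix). The right interface vector is $\tau^{\ge}_{k+1,\ell}(c)(i_{k+1},\dots,i_d)=\sum_{j_{k+1},\dots,j_{d-1}}C_{k+1}(\ell,i_{k+1},j_{k+1})\cdots C_d(j_{d-1},i_d)$, where the tensor train is assumed right orthogonal (for each of $C_2,\dots,C_d$, contracting the component with itself over all indices but the first gives the identity matrix). **Block-sparse representation and block sizes.** For a nonzero tensor train $c$ of rank $r=(r_1,\dots,r_{d-1})$ it is known that $Lc=gc$ if and only if $c$ has a representation with component tensors $C_k\in\mathbb{R}^{r_{k-1}\times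 p\times r_k}$ such that: 1. For all $\tilde g\in\{0,1,\dots,g\}$ there exist sets $\mathcal{S}_{k,\tilde g}\subseteq\{1,\dots,r_k\}$ with $L^{\le}_k\tau^{\le}_{k,\ell}(c)=\tilde g\,\tau^{\le}_{k,\ell}(c)$ and $L^{\ge}_{k+1}\tau^{\ge}_{k+1,\ell}(c)=(g-\tilde g)\,\tau^{\ge}_{k+1,\ell}(c)$ for $\ell\in\mathcal{S}_{k,\tilde g}$. The set $\mathcal{S}_{k,\tilde g}$ contains all the indices $\ell$ for which the polynomial corresponding to $\tau^{\le}_{k,\ell}(c)$ is homogeneous of degree $\tilde g$. 2. For $m=1,\dots,p$: if $C_k(\ell_1,m,\ell_2)\ne0$, then there is $0\le\tilde g\le g-(m-1)$ with $\ell_1\in\mathcal{S}_{k-1,\tilde g}$ and $\ell_2\in\mathcal{S}_{k,\tilde g+(m-1)}$, where $\mathcal{S}_{0,0}=\mathcal{S}_{d,g}=\{1\}$. The block sizes are $\rho_{k,\tilde g}=|\mathcal{S}_{k,\tilde g}|$ for $k=1,\dots,d-1$ and $\tilde g=0,\dots,g$.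
   Formalization: Proved: some representation has all these block sizes; every one of minimal TT rank obeys the bounds, but there ρ_{k,0} (ρ_{k,g}) is 1 only if u has a monomial in x_{k+1},…,x_d (x_1,…,x_k) alone, else 0. As stated it fails for u=x_1^g, and padded representations can exceed the bounds. *)

theory Defs
  imports Complex_Main "HOL-Library.FuncSet"
begin

text \<open>
  Tensors of order \<open>n\<close> with mode size \<open>p\<close> are functions on index lists; only their values on
  \<open>idx n p\<close> (lists of length \<open>n\<close> with entries in \<open>{1..p}\<close>) are meaningful. Lists are 0-based, so
  \<open>i\<^sub>k\<close> is \<open>is ! (k - 1)\<close>.
\<close>

type_synonym tensor = "nat list \<Rightarrow> real"

definition idx :: "nat \<Rightarrow> nat \<Rightarrow> nat list set" where
  "idx n p = {is. length is = n \<and> set is \<subseteq> {1..p}}"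

definition nonzero_tensor :: "nat \<Rightarrow> nat \<Rightarrow> tensor \<Rightarrow> bool" where
  "nonzero_tensor n p c \<longleftrightarrow> (\<exists>is\<in>idx n p. c is \<noteq> 0)"


section \<open>Degree operator\<close>

type_synonym smat = "nat \<Rightarrow> nat \<Rightarrow> real"

definition mat_I :: smat where
  "mat_I i j = (if i = j then 1 else 0)"

definition mat_N :: smat where
  "mat_N i j = (if i = j then real i - 1 else 0)"

definition kron :: "smat list \<Rightarrow> nat list \<Rightarrow> nat list \<Rightarrow> real" where
  "kron As is js = (\<Prod>q<length As. (As ! q) (is ! q) (js ! q))"

text \<open>
  With \<open>n = d\<close> this is the operator \<open>L\<close>, with \<open>n = k\<close> the partial operator acting on the first
  \<open>k\<close> indices, and with \<open>n = d - k\<close> the one acting on the last \<open>d - k\<close> indices (after shifting the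
  summation index).
\<close>

definition deg_op :: "nat \<Rightarrow> nat \<Rightarrow> tensor \<Rightarrow> tensor" where
  "deg_op n p x is =
     (\<Sum>js\<in>idx n p.
        (\<Sum>m=1..n. kron (replicate (m - 1) mat_I @ [mat_N] @ replicate (n - m) mat_I) is js) * x js)"

text \<open>The polynomial with coefficient tensor \<open>x\<close> is homogeneous of degree \<open>h\<close>: \<open>L x = h x\<close>.\<close>

definition homogeneous :: "nat \<Rightarrow> nat \<Rightarrow> nat \<Rightarrow> tensor \<Rightarrow> bool" where
  "homogeneous n p h x \<longleftrightarrow> (\<forall>is\<in>idx n p. deg_op n p x is = real h * x is)"


section \<open>Variable locality\<close>

definition mult_index :: "nat \<Rightarrow> nat list \<Rightarrow> nat list" where
  "mult_index d ns = map (\<lambda>k. 1 + count_list ns k) [1..<Suc d]"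

definition multinomial :: "nat list \<Rightarrow> real" where
  "multinomial as = fact (sum_list as) / (\<Prod>q<length as. fact (as ! q))"

text \<open>
  The symmetric tensor \<open>B\<close>. For \<open>ns\<close> of length \<open>g\<close> with entries in \<open>{1..d}\<close> the numbers
  \<open>m\<^sub>k - 1\<close> add up to \<open>g\<close>.
\<close>

definition sym_coeff :: "nat \<Rightarrow> tensor \<Rightarrow> tensor" where
  "sym_coeff d c ns =
     inverse (multinomial (map (\<lambda>m. m - 1) (mult_index d ns))) * c (mult_index d ns)"

text \<open>
  The maximum of the distances exceeds \<open>K\<close> iff one of them does; for \<open>g = 0\<close> there are none and
  the condition is void.
\<close>

definition variable_locality :: "nat \<Rightarrow> nat \<Rightarrow> nat \<Rightarrow> tensor \<Rightarrow> bool" where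
  "variable_locality d g K c \<longleftrightarrow>
     (\<forall>ls\<in>idx g d. (\<exists>a<g. \<exists>b<g. \<bar>int (ls ! a) - int (ls ! b)\<bar> > int K) \<longrightarrow> sym_coeff d c ls = 0)"


section \<open>Tensor trains\<close>

text \<open>
  \<open>C k l m l'\<close> is the entry \<open>C\<^sub>k(l, m, l')\<close> of the \<open>k\<close>-th component; ranks are \<open>r 0, ..., r d\<close> with
  \<open>r 0 = r d = 1\<close>.
\<close>

type_synonym components = "nat \<Rightarrow> nat \<Rightarrow> nat \<Rightarrow> nat \<Rightarrow> real"

text \<open>
  Contraction of the components \<open>a + 1, ..., b\<close> (for \<open>a < b\<close>) over the inner rank indices, with
  outer rank indices \<open>j\<^sub>a = l\<close> and \<open>j\<^sub>b = l'\<close>.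
\<close>

definition tt_segment ::
    "components \<Rightarrow> (nat \<Rightarrow> nat) \<Rightarrow> nat \<Rightarrow> nat \<Rightarrow> nat \<Rightarrow> nat \<Rightarrow> tensor" where
  "tt_segment C r a b l l' is =
     (\<Sum>j \<in> PiE {a..b} (\<lambda>q. if q = a then {l} else if q = b then {l'} else {1..r q}).
        \<Prod>q\<in>{a<..b}. C q (j (q - 1)) (is ! (q - a - 1)) (j q))"

definition tt_represents ::
    "nat \<Rightarrow> nat \<Rightarrow> (nat \<Rightarrow> nat) \<Rightarrow> components \<Rightarrow> tensor \<Rightarrow> bool" where
  "tt_represents d p r C c \<longleftrightarrow>
     r 0 = 1 \<and> r d = 1 \<and> (\<forall>is\<in>idx d p. c is = tt_segment C r 0 d 1 1 is)"

definition tt_rank :: "nat \<Rightarrow> nat \<Rightarrow> tensor \<Rightarrow> (nat \<Rightarrow> nat) \<Rightarrow> bool" where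
  "tt_rank d p c r \<longleftrightarrow>
     (\<exists>C. tt_represents d p r C c) \<and>
     (\<forall>r' C'. tt_represents d p r' C' c \<longrightarrow> (\<forall>k\<in>{1..<d}. r k \<le> r' k))"

definition left_orthogonal :: "nat \<Rightarrow> nat \<Rightarrow> (nat \<Rightarrow> nat) \<Rightarrow> components \<Rightarrow> bool" where
  "left_orthogonal d p r C \<longleftrightarrow>
     (\<forall>k\<in>{1..<d}. \<forall>l\<in>{1..r k}. \<forall>l'\<in>{1..r k}.
        (\<Sum>j=1..r (k - 1). \<Sum>m=1..p. C k j m l * C k j m l') = mat_I l l')"

definition right_orthogonal :: "nat \<Rightarrow> nat \<Rightarrow> (nat \<Rightarrow> nat) \<Rightarrow> components \<Rightarrow> bool" where
  "right_orthogonal d p r C \<longleftrightarrow>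
     (\<forall>k\<in>{2..d}. \<forall>l\<in>{1..r (k - 1)}. \<forall>l'\<in>{1..r (k - 1)}.
        (\<Sum>m=1..p. \<Sum>j=1..r k. C k l m j * C k l' m j) = mat_I l l')"

definition left_interface ::
    "components \<Rightarrow> (nat \<Rightarrow> nat) \<Rightarrow> nat \<Rightarrow> nat \<Rightarrow> tensor" where
  "left_interface C r k l = tt_segment C r 0 k 1 l"

text \<open>\<open>right_interface d C r k l\<close> is the vector \<open>\<tau>\<^sup>\<ge>\<close> with subscript \<open>k + 1, l\<close>.\<close>

definition right_interface ::
    "nat \<Rightarrow> components \<Rightarrow> (nat \<Rightarrow> nat) \<Rightarrow> nat \<Rightarrow> nat \<Rightarrow> tensor" where
  "right_interface d C r k l = tt_segment C r k d l 1"


section \<open>Block-sparse representations\<close>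

definition block_sparse ::
    "nat \<Rightarrow> nat \<Rightarrow> nat \<Rightarrow> (nat \<Rightarrow> nat) \<Rightarrow> (nat \<Rightarrow> nat \<Rightarrow> nat set) \<Rightarrow> components \<Rightarrow> bool" where
  "block_sparse d p g r S C \<longleftrightarrow>
     (\<forall>k\<in>{1..d}. \<forall>l1\<in>{1..r (k - 1)}. \<forall>m\<in>{1..p}. \<forall>l2\<in>{1..r k}.
        C k l1 m l2 \<noteq> 0 \<longrightarrow>
          (\<exists>h. h + (m - 1) \<le> g \<and> l1 \<in> S (k - 1) h \<and> l2 \<in> S k (h + (m - 1))))"

text \<open>
  Left interface vectors are those of a left orthogonal tensor train, right interface vectors those
  of a right orthogonal one. In general no single tensor train is both, so a representation
  consists of a left orthogonal form \<open>CL\<close> and a right orthogonal form \<open>CR\<close> of \<open>c\<close>, with the same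
  ranks and the same block index sets \<open>S k h\<close>.
\<close>

definition block_sparse_rep ::
    "nat \<Rightarrow> nat \<Rightarrow> nat \<Rightarrow> tensor \<Rightarrow> (nat \<Rightarrow> nat) \<Rightarrow> components \<Rightarrow> components \<Rightarrow>
      (nat \<Rightarrow> nat \<Rightarrow> nat set) \<Rightarrow> bool" where
  "block_sparse_rep d p g c r CL CR S \<longleftrightarrow>
     tt_represents d p r CL c \<and> left_orthogonal d p r CL \<and>
     tt_represents d p r CR c \<and> right_orthogonal d p r CR \<and>
     (\<forall>k\<in>{1..<d}. \<forall>h\<le>g. S k h = {l\<in>{1..r k}. homogeneous k p h (left_interface CL r k l)}) \<and>
     (\<forall>k\<in>{1..<d}. \<forall>h\<le>g. \<forall>l\<in>S k h. homogeneous (d - k) p (g - h) (right_interface d CR r k l)) \<and>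
     (\<forall>h\<le>g. S 0 h = (if h = 0 then {1} else {}) \<and> S d h = (if h = g then {1} else {})) \<and>
     block_sparse d p g r S CL \<and> block_sparse d p g r S CR"

definition locality_bound :: "nat \<Rightarrow> nat \<Rightarrow> nat \<Rightarrow> nat" where
  "locality_bound K g h =
     (\<Sum>l=1..K. min ((K - l + 1 + h - 2) choose (K - l)) ((l + g - h - 2) choose (l - 1)))"

text \<open>The polynomial of \<open>c\<close> contains a monomial in which only variables \<open>x\<^sub>k\<close>, \<open>k \<in> V\<close>, occur.\<close>

definition has_monomial_in :: "nat \<Rightarrow> nat \<Rightarrow> tensor \<Rightarrow> nat set \<Rightarrow> bool" where
  "has_monomial_in d p c V \<longleftrightarrow>
     (\<exists>is\<in>idx d p. c is \<noteq> 0 \<and> (\<forall>k\<in>{1..d}. is ! (k - 1) \<noteq> 1 \<longrightarrow> k \<in> V))"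

end

theory Submission
  imports Defs
begin

text \<open>
  The block of \<open>c\<close> at position \<open>k\<close> and degree \<open>h\<close> is the matrix whose rows are the monomials of
  degree \<open>h\<close> in the first \<open>k\<close> variables and whose columns are those of degree \<open>g - h\<close> in the
  remaining ones; every other entry of the \<open>k\<close>-th unfolding vanishes. In any block-sparse
  representation the interface vectors indexed by \<open>S k h\<close> factorize this block, so its rank is at most
  \<open>card (S k h)\<close>, and these cardinalities add up to at most \<open>r k\<close>. Conversely, orthonormal bases of
  the column spaces of the blocks form a left orthogonal train, and those of the row spaces a right
  orthogonal one, with block sizes equal to the block ranks. Hence minimal ranks force equality.

  By locality a row whose least variable is \<open>k - K + l\<close> meets only columns in the variables
  \<open>k + 1, ..., k + l\<close>. The nonzero pattern is therefore a staircase, and it is covered by the rows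
  with \<open>l > t\<close> and the columns whose greatest variable is at most \<open>k + t\<close>. The number of rows
  added at step \<open>l\<close> decreases with \<open>l\<close> and the number of columns increases, so a suitable \<open>t\<close> picks
  the smaller of the two for every \<open>l\<close>, which is the stated sum of minima.

  The blocks of degrees \<open>0\<close> and \<open>g\<close> have rank at most one. Where one of them vanishes, size one is
  obtained by adding \<open>x\<^sub>d\<^sup>g\<close> or \<open>x\<^sub>1\<^sup>g\<close> to \<open>c\<close> at that position only.
\<close>

section \<open>Orthonormal bases of column spaces and matrix rank\<close>

definition ip :: "'a set \<Rightarrow> ('a \<Rightarrow> real) \<Rightarrow> ('a \<Rightarrow> real) \<Rightarrow> real" where
  "ip X u v = (\<Sum>x\<in>X. u x * v x)"

definition orthonormal :: "'a set \<Rightarrow> 'i set \<Rightarrow> ('i \<Rightarrow> 'a \<Rightarrow> real) \<Rightarrow> bool" where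
  "orthonormal X I q \<longleftrightarrow> (\<forall>i\<in>I. \<forall>j\<in>I. ip X (q i) (q j) = (if i = j then 1 else 0))"

lemma ip_commute: "ip X u v = ip X v u"
  by (simp add: ip_def mult.commute)

lemma ip_cong: "(\<And>x. x \<in> X \<Longrightarrow> u x = u' x) \<Longrightarrow> (\<And>x. x \<in> X \<Longrightarrow> v x = v' x) \<Longrightarrow> ip X u v = ip X u' v'"
  by (simp add: ip_def)

lemma ip_sum_right: "ip X u (\<lambda>x. \<Sum>i\<in>I. f i x * c i) = (\<Sum>i\<in>I. ip X u (f i) * c i)"
  unfolding ip_def sum_distrib_left sum_distrib_right
  by (subst sum.swap) (simp add: mult.assoc)

lemma ip_diff_right: "ip X u (\<lambda>x. f x - h x) = ip X u f - ip X u h"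
  by (simp add: ip_def algebra_simps sum_subtractf)

lemma ip_scale_right: "ip X u (\<lambda>x. f x / c) = ip X u f / c"
  by (simp add: ip_def sum_divide_distrib)

lemma ip_self_nonneg: "0 \<le> ip X u u"
  by (simp add: ip_def sum_nonneg)

lemma ip_self_eq_0:
  assumes "finite X" "ip X u u = 0" "x \<in> X"
  shows "u x = 0"
  using assms by (simp add: ip_def sum_nonneg_eq_0_iff)

lemma orthonormal_coeff:
  assumes "orthonormal X I q" "finite I" "i \<in> I"
  shows "ip X (q i) (\<lambda>x. \<Sum>j\<in>I. q j x * c j) = c i"
proof -
  have "ip X (q i) (\<lambda>x. \<Sum>j\<in>I. q j x * c j) = (\<Sum>j\<in>I. ip X (q i) (q j) * c j)"
    by (rule ip_sum_right)
  also have "\<dots> = (\<Sum>j\<in>I. if i = j then c j else 0)"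
    using assms by (intro sum.cong) (auto simp: orthonormal_def)
  finally show ?thesis using assms by simp
qed

text \<open>The projection \<open>s\<close> of \<open>v\<close> satisfies
  \<open>ip X v s = ip X s s\<close>, both being the sum of squares; the inequality says that
  \<open>v - s\<close> has nonnegative squared norm.\<close>

lemma bessel:
  assumes "orthonormal X I q" "finite I"
  shows "(\<Sum>i\<in>I. (ip X (q i) v)\<^sup>2) \<le> ip X v v"
proof -
  define s where "s = (\<lambda>x. \<Sum>i\<in>I. q i x * ip X (q i) v)"
  have 1: "ip X v s = (\<Sum>i\<in>I. (ip X (q i) v)\<^sup>2)"
    by (simp add: s_def ip_sum_right ip_commute[of X v] power2_eq_square)
  have "ip X (q i) s = ip X (q i) v" if "i \<in> I" for i
    unfolding s_def by (rule orthonormal_coeff[OF assms that])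
  then have "ip X s (\<lambda>x. \<Sum>i\<in>I. q i x * ip X (q i) v) = (\<Sum>i\<in>I. (ip X (q i) v)\<^sup>2)"
    by (simp add: ip_sum_right ip_commute[of X s] power2_eq_square)
  then have 2: "ip X s s = (\<Sum>i\<in>I. (ip X (q i) v)\<^sup>2)"
    by (simp only: s_def)
  have "0 \<le> ip X (\<lambda>x. v x - s x) (\<lambda>x. v x - s x)"
    by (rule ip_self_nonneg)
  also have "\<dots> = ip X v v - ip X v s - (ip X s v - ip X s s)"
    by (simp add: ip_diff_right ip_commute[of X "\<lambda>x. v x - s x"])
  finally show ?thesis using 1 2 by (simp add: ip_commute[of X s v])
qed

text \<open>Double counting of the squares of \<open>ip X (q i) (e j)\<close>: summed over
  \<open>j\<close> they give 1, as \<open>q i\<close> lies in the span of the \<open>e j\<close>,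
  and summed over \<open>i\<close> at most 1 by Bessel's inequality.\<close>

lemma orthonormal_card_le:
  assumes q: "orthonormal X I q" "finite I" and e: "orthonormal X J e" "finite J"
    and span: "\<And>i x. i \<in> I \<Longrightarrow> x \<in> X \<Longrightarrow> q i x = (\<Sum>j\<in>J. e j x * c i j)"
  shows "card I \<le> card J"
proof -
  have c: "ip X (e j) (q i) = c i j" if "i \<in> I" "j \<in> J" for i j
    using orthonormal_coeff[OF e that(2), of "c i"] span[OF that(1)]
    by (simp add: ip_def)
  have "ip X (q i) (q i) = (\<Sum>j\<in>J. (ip X (q i) (e j))\<^sup>2)" if "i \<in> I" for i
  proof -
    have "ip X (q i) (q i) = ip X (q i) (\<lambda>x. \<Sum>j\<in>J. e j x * c i j)"
      by (intro ip_cong) (simp_all add: span[OF that])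
    also have "\<dots> = (\<Sum>j\<in>J. (ip X (q i) (e j))\<^sup>2)"
      unfolding ip_sum_right
      by (intro sum.cong) (simp_all add: c[OF that, symmetric] ip_commute power2_eq_square)
    finally show ?thesis .
  qed
  then have "real (card I) = (\<Sum>i\<in>I. \<Sum>j\<in>J. (ip X (q i) (e j))\<^sup>2)"
    using q by (simp add: orthonormal_def)
  also have "\<dots> = (\<Sum>j\<in>J. \<Sum>i\<in>I. (ip X (q i) (e j))\<^sup>2)"
    by (rule sum.swap)
  also have "\<dots> \<le> (\<Sum>j\<in>J. ip X (e j) (e j))"
    by (intro sum_mono bessel q)
  also have "\<dots> = real (card J)"
    using e by (simp add: orthonormal_def)
  finally show ?thesis by simp
qed

text \<open>Columns are processed one by one; the normalized residual of a column becomes a new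
  basis vector unless it is zero. The coefficients \<open>w\<close> record that the basis stays
  inside the column space.\<close>

lemma gram_schmidt:
  assumes "finite X" "finite Y"
  shows "\<exists>s\<le>card Y. \<exists>q b w. orthonormal X {..<s} q \<and>
    (\<forall>x\<in>X. \<forall>y\<in>Y. M x y = (\<Sum>l<s. q l x * b l y)) \<and>
    (\<forall>x\<in>X. \<forall>l<s. q l x = (\<Sum>y\<in>Y. M x y * w l y))"
  using assms(2)
proof (induction Y)
  case empty
  show ?case by (intro exI[of _ 0]) (simp add: orthonormal_def)
next
  case (insert z Y)
  from insert.IH obtain s q b w where s: "s \<le> card Y" and on: "orthonormal X {..<s} q"
    and M: "\<forall>x\<in>X. \<forall>y\<in>Y. M x y = (\<Sum>l<s. q l x * b l y)"
    and w: "\<forall>x\<in>X. \<forall>l<s. q l x = (\<Sum>y\<in>Y. M x y * w l y)"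
    by (elim exE conjE)
  define a where "a l = ip X (q l) (\<lambda>x. M x z)" for l
  define v where "v x = M x z - (\<Sum>l<s. q l x * a l)" for x
  have nz: "y \<noteq> z" if "y \<in> Y" for y using that insert.hyps by auto
  have orth: "ip X (q l) v = 0" if "l < s" for l
    using orthonormal_coeff[OF on, of l a] that by (simp add: v_def[abs_def] ip_diff_right a_def)
  define n where "n = sqrt (ip X v v)"
  show ?case
  proof (cases "n = 0")
    case True
    then have "v x = 0" if "x \<in> X" for x
      using ip_self_eq_0[OF assms(1) _ that] by (simp add: n_def)
    then have "M x z = (\<Sum>l<s. q l x * a l)" if "x \<in> X" for x
      using that by (simp add: v_def)
    then have 1: "\<forall>x\<in>X. \<forall>y\<in>insert z Y. M x y = (\<Sum>l<s. q l x * (if y = z then a l else b l y))"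
      using M nz by auto
    have 2: "\<forall>x\<in>X. \<forall>l<s. q l x = (\<Sum>y\<in>insert z Y. M x y * (if y = z then 0 else w l y))"
      using w insert.hyps nz by (auto intro!: sum.cong)
    have 3: "s \<le> card (insert z Y)" using s insert.hyps by simp
    show ?thesis by (intro exI conjI) (rule 3 on 1 2)+
  next
    case False
    then have n: "n > 0" using ip_self_nonneg[of X v] by (simp add: n_def)
    have nn: "n * n = ip X v v" using ip_self_nonneg[of X v] by (simp add: n_def)
    define q' where "q' = q(s := (\<lambda>x. v x / n))"
    have "ip X (q' i) (q' j) = (if i = j then 1 else 0)" if "i < Suc s" "j < Suc s" for i j
    proof -
      have "ip X (\<lambda>x. v x / n) (\<lambda>x. v x / n) = 1"
        using nn[symmetric] n by (simp add: ip_scale_right ip_commute[of X "\<lambda>x. v x / n"] field_simps)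
      moreover have "ip X (q l) (\<lambda>x. v x / n) = 0" "ip X (\<lambda>x. v x / n) (q l) = 0" if "l < s" for l
        using orth[OF that] by (simp_all add: ip_scale_right ip_commute[of X "\<lambda>x. v x / n"])
      moreover have "ip X (q i) (q j) = (if i = j then 1 else 0)" if "i < s" "j < s"
        using on that by (simp add: orthonormal_def)
      ultimately show ?thesis using that by (auto simp: q'_def less_Suc_eq)
    qed
    then have 1: "orthonormal X {..<Suc s} q'" by (simp add: orthonormal_def)
    define b' where "b' l y = (if y = z then (if l = s then n else a l) else (if l = s then 0 else b l y))" for l y
    have 2: "M x y = (\<Sum>l<Suc s. q' l x * b' l y)" if "x \<in> X" "y \<in> insert z Y" for x y
    proof (cases "y = z")
      case True
      have "(\<Sum>l<s. q' l x * b' l y) = (\<Sum>l<s. q l x * a l)"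
        by (intro sum.cong) (auto simp: q'_def b'_def True)
      then show ?thesis using n by (simp add: True q'_def b'_def v_def)
    next
      case False
      have "(\<Sum>l<s. q' l x * b' l y) = (\<Sum>l<s. q l x * b l y)"
        by (intro sum.cong) (auto simp: q'_def b'_def False)
      then show ?thesis using M that False by (simp add: b'_def)
    qed
    \<comment> \<open>\<open>t\<close> writes the projection of column \<open>z\<close> onto the old
      basis as a combination of the old columns.\<close>
    define t where "t y = (\<Sum>l<s. w l y * a l)" for y
    define w' where "w' l y = (if l = s then (if y = z then 1 / n else - t y / n)
        else if y = z then 0 else w l y)" for l y
    have 3: "q' l x = (\<Sum>y\<in>insert z Y. M x y * w' l y)" if "x \<in> X" "l < Suc s" for x l
    proof (cases "l = s")
      case True
      have "(\<Sum>l<s. q l x * a l) = (\<Sum>l<s. \<Sum>y\<in>Y. M x y * w l y * a l)"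
        using w that(1) by (simp add: sum_distrib_right)
      also have "\<dots> = (\<Sum>y\<in>Y. M x y * (\<Sum>l<s. w l y * a l))"
        by (subst sum.swap) (simp add: sum_distrib_left mult.assoc)
      also have "\<dots> = (\<Sum>y\<in>Y. M x y * t y)"
        by (simp add: t_def)
      finally have "(\<Sum>y\<in>Y. M x y * w' l y) = - (\<Sum>l<s. q l x * a l) / n"
        using nz by (simp add: True w'_def sum_negf[symmetric] sum_divide_distrib)
      then show ?thesis
        using insert.hyps n by (simp add: True q'_def w'_def v_def diff_divide_distrib)
    next
      case False
      have "(\<Sum>y\<in>Y. M x y * w' l y) = (\<Sum>y\<in>Y. M x y * w l y)"
        using nz False by (intro sum.cong) (auto simp: w'_def)
      then show ?thesis
        using insert.hyps w that False by (simp add: q'_def w'_def)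
    qed
    have 4: "Suc s \<le> card (insert z Y)" using s insert.hyps by simp
    show ?thesis by (intro exI conjI ballI allI impI) (rule 4, rule 1, rule 2, assumption+, rule 3, assumption+)
  qed
qed

section \<open>Matrix rank through factorizations\<close>

definition mrank :: "'a set \<Rightarrow> 'b set \<Rightarrow> ('a \<Rightarrow> 'b \<Rightarrow> real) \<Rightarrow> nat" where
  "mrank X Y M =
     (LEAST s. \<exists>a b. \<forall>x\<in>X. \<forall>y\<in>Y. M x y = (\<Sum>l<s. a l x * b l y))"

lemma mrank_le:
  assumes "finite I"
    and "\<And>x y. x \<in> X \<Longrightarrow> y \<in> Y \<Longrightarrow> M x y = (\<Sum>i\<in>I. a i x * b i y)"
  shows "mrank X Y M \<le> card I"
proof -
  obtain f where "bij_betw f {0..<card I} I"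
    using ex_bij_betw_nat_finite[OF assms(1)] by blast
  then have "bij_betw f {..<card I} I" by (simp add: atLeast0LessThan)
  then have "(\<Sum>i\<in>I. a i x * b i y) = (\<Sum>l<card I. a (f l) x * b (f l) y)" for x y
    by (simp add: sum.reindex_bij_betw[of f _ _ "\<lambda>i. a i x * b i y", symmetric])
  then have "\<exists>a b. \<forall>x\<in>X. \<forall>y\<in>Y. M x y = (\<Sum>l<card I. a l x * b l y)"
    using assms(2) by (intro exI[of _ "\<lambda>l. a (f l)"] exI[of _ "\<lambda>l. b (f l)"]) simp
  then show ?thesis unfolding mrank_def by (rule Least_le)
qed

text \<open>The factorization with one unit vector per row exists, so the minimum in
  \<open>mrank\<close> is attained.\<close>

lemma mrank_factorization:
  assumes "finite X"
  shows "\<exists>a b. \<forall>x\<in>X. \<forall>y\<in>Y. M x y = (\<Sum>l<mrank X Y M. a l x * b l y)"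
proof -
  obtain f where f: "bij_betw f {0..<card X} X"
    using ex_bij_betw_nat_finite[OF assms(1)] by blast
  then have f: "bij_betw f {..<card X} X" by (simp add: atLeast0LessThan)
  have "M x y = (\<Sum>l<card X. (if f l = x then 1 else 0) * M (f l) y)" if "x \<in> X" for x y
  proof -
    have "(\<Sum>l<card X. (if f l = x then 1 else 0) * M (f l) y) = (\<Sum>u\<in>X. (if u = x then 1 else 0) * M u y)"
      by (rule sum.reindex_bij_betw[OF f])
    also have "\<dots> = (\<Sum>u\<in>X. if u = x then M u y else 0)"
      by (intro sum.cong) auto
    finally show ?thesis using assms that by simp
  qed
  then have "\<exists>a b. \<forall>x\<in>X. \<forall>y\<in>Y. M x y = (\<Sum>l<card X. a l x * b l y)"
    by (intro exI[of _ "\<lambda>l x. if f l = x then 1 else 0"] exI[of _ "\<lambda>l y. M (f l) y"]) simp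
  then show ?thesis unfolding mrank_def by (rule LeastI)
qed

lemma mrank_eq_0_iff:
  assumes "finite X"
  shows "mrank X Y M = 0 \<longleftrightarrow> (\<forall>x\<in>X. \<forall>y\<in>Y. M x y = 0)"
proof
  assume 0: "mrank X Y M = 0"
  obtain a b where "\<forall>x\<in>X. \<forall>y\<in>Y. M x y = (\<Sum>l<mrank X Y M. a l x * b l y)"
    using mrank_factorization[of X Y M, OF assms] by (elim exE)
  then show "\<forall>x\<in>X. \<forall>y\<in>Y. M x y = 0" by (simp add: 0)
next
  assume "\<forall>x\<in>X. \<forall>y\<in>Y. M x y = 0"
  then have "mrank X Y M \<le> card ({} :: nat set)"
    by (intro mrank_le) simp_all
  then show "mrank X Y M = 0" by simp
qed

text \<open>Each row in \<open>A\<close> and each column in \<open>B\<close> is one rank-one term.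
  The columns are cleared on the rows of \<open>A\<close>, so that no entry is counted
  twice.\<close>

lemma mrank_le_cover:
  assumes "finite A" "finite B"
    and "\<And>x y. x \<in> X \<Longrightarrow> y \<in> Y \<Longrightarrow> M x y \<noteq> 0 \<Longrightarrow> x \<in> A \<or> y \<in> B"
  shows "mrank X Y M \<le> card A + card B"
proof -
  define a where "a i x = (case i of Inl u \<Rightarrow> if x = u then 1 else 0 | Inr v \<Rightarrow> if x \<in> A then 0 else M x v)" for i x
  define b where "b i y = (case i of Inl u \<Rightarrow> M u y | Inr v \<Rightarrow> if y = v then 1 else 0)" for i y
  have "M x y = (\<Sum>i\<in>A <+> B. a i x * b i y)" if "x \<in> X" "y \<in> Y" for x y
  proof -
    have "(\<Sum>i\<in>A <+> B. a i x * b i y) =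
        (\<Sum>u\<in>A. (if x = u then 1 else 0) * M u y) +
        (\<Sum>v\<in>B. (if x \<in> A then 0 else M x v) * (if y = v then 1 else 0))"
      using assms by (simp add: sum.Plus a_def b_def)
    also have "\<dots> = (\<Sum>u\<in>A. if x = u then M u y else 0) +
        (\<Sum>v\<in>B. if y = v then (if x \<in> A then 0 else M x v) else 0)"
      by (intro arg_cong2[of _ _ _ _ "(+)"] sum.cong) auto
    also have "\<dots> = M x y"
      using assms(1,2) assms(3)[OF that] by auto
    finally show ?thesis by simp
  qed
  then have "mrank X Y M \<le> card (A <+> B)"
    using assms by (intro mrank_le) auto
  then show ?thesis using assms by (simp add: card_Plus)
qed

text \<open>The two factors of a minimal factorization trade places. Reversing the order of the
  variables transposes blocks in this way, with \<open>f\<close> and \<open>h\<close> as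
  relabellings.\<close>

lemma mrank_transpose_le:
  assumes "finite X"
    and "\<And>y. y \<in> Y' \<Longrightarrow> f y \<in> X" "\<And>x. x \<in> X' \<Longrightarrow> h x \<in> Y"
    and "\<And>x y. x \<in> X' \<Longrightarrow> y \<in> Y' \<Longrightarrow> M' x y = M (f y) (h x)"
  shows "mrank X' Y' M' \<le> mrank X Y M"
proof -
  obtain a b where ab: "\<forall>x\<in>X. \<forall>y\<in>Y. M x y = (\<Sum>l<mrank X Y M. a l x * b l y)"
    using mrank_factorization[of X Y M, OF assms(1)] by (elim exE)
  have "mrank X' Y' M' \<le> card {..<mrank X Y M}"
    by (rule mrank_le[where a = "\<lambda>l x. b l (h x)" and b = "\<lambda>l y. a l (f y)"])
      (simp_all add: assms ab mult.commute)
  then show ?thesis by simp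
qed

text \<open>Gram-Schmidt produces exactly as many vectors as the rank: at least, because they
  factorize \<open>M\<close>; at most, because they lie in the span of the left factor of a minimal
  factorization. The index set \<open>I\<close> is arbitrary, so that the bases of several blocks
  can share one range of indices.\<close>

lemma mrank_orthonormal_basis:
  assumes "finite X" "finite Y" "finite I" "card I = mrank X Y M"
  obtains q b w where "orthonormal X I q"
    and "\<And>x y. x \<in> X \<Longrightarrow> y \<in> Y \<Longrightarrow> M x y = (\<Sum>i\<in>I. q i x * b i y)"
    and "\<And>x i. x \<in> X \<Longrightarrow> i \<in> I \<Longrightarrow> q i x = (\<Sum>y\<in>Y. M x y * w i y)"
proof -
  obtain s q b w where on: "orthonormal X {..<s::nat} q"
    and M: "\<forall>x\<in>X. \<forall>y\<in>Y. M x y = (\<Sum>l<s. q l x * b l y)"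
    and w: "\<forall>x\<in>X. \<forall>l<s. q l x = (\<Sum>y\<in>Y. M x y * w l y)"
    using gram_schmidt[OF assms(1,2), of M] by (elim exE conjE)
  obtain a b' where ab: "\<forall>x\<in>X. \<forall>y\<in>Y. M x y = (\<Sum>l<mrank X Y M. a l x * b' l y)"
    using mrank_factorization[of X Y M, OF assms(1)] by (elim exE)
  \<comment> \<open>Orthonormalizing the left factor of a minimal factorization leaves at most
    \<open>mrank X Y M\<close> vectors, whose span contains all columns of \<open>M\<close>.\<close>
  obtain s' e b'' where s': "s' \<le> card {..<mrank X Y M}" and on': "orthonormal X {..<s'} e"
    and a: "\<forall>x\<in>X. \<forall>l\<in>{..<mrank X Y M}. a l x = (\<Sum>j<s'. e j x * b'' j l)"
    using gram_schmidt[OF assms(1) finite_lessThan, of "mrank X Y M" "\<lambda>x l. a l x"] by (elim exE conjE)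
  have "q i x = (\<Sum>j<s'. e j x * (\<Sum>y\<in>Y. \<Sum>l<mrank X Y M. b'' j l * b' l y * w i y))"
    if "i < s" "x \<in> X" for i x
  proof -
    have "q i x = (\<Sum>y\<in>Y. (\<Sum>l<mrank X Y M. (\<Sum>j<s'. e j x * b'' j l) * b' l y) * w i y)"
      using w ab a that by simp
    also have "\<dots> = (\<Sum>y\<in>Y. \<Sum>l<mrank X Y M. \<Sum>j<s'. e j x * (b'' j l * b' l y * w i y))"
      by (simp add: sum_distrib_right mult.assoc)
    also have "\<dots> = (\<Sum>y\<in>Y. \<Sum>j<s'. \<Sum>l<mrank X Y M. e j x * (b'' j l * b' l y * w i y))"
      by (intro sum.cong refl sum.swap)
    also have "\<dots> = (\<Sum>j<s'. \<Sum>y\<in>Y. \<Sum>l<mrank X Y M. e j x * (b'' j l * b' l y * w i y))"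
      by (rule sum.swap)
    finally show ?thesis by (simp add: sum_distrib_left)
  qed
  then have "card {..<s} \<le> card {..<s'}"
    by (intro orthonormal_card_le[OF on _ on']) auto
  moreover have "mrank X Y M \<le> card {..<s}"
    by (rule mrank_le) (simp_all add: M)
  ultimately have "s = card I" using s' assms(4) by simp
  moreover obtain f where "bij_betw f I {0..<card I}"
    using ex_bij_betw_finite_nat[OF assms(3)] by blast
  ultimately have f: "bij_betw f I {..<s}" by (simp add: atLeast0LessThan)
  have fI: "f i < s" if "i \<in> I" for i using f that by (auto simp: bij_betw_def)
  have "inj_on f I" using f by (simp add: bij_betw_def)
  then have "orthonormal X I (\<lambda>i. q (f i))"
    using on fI by (auto simp: orthonormal_def inj_on_def)
  moreover have "M x y = (\<Sum>i\<in>I. q (f i) x * b (f i) y)" if "x \<in> X" "y \<in> Y" for x y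
    using M that sum.reindex_bij_betw[OF f, of "\<lambda>l. q l x * b l y"] by simp
  moreover have "q (f i) x = (\<Sum>y\<in>Y. M x y * w (f i) y)" if "x \<in> X" "i \<in> I" for x i
    using w fI that by simp
  ultimately show ?thesis by (rule that)
qed


section \<open>Index lists and degrees\<close>

text \<open>The degree of a monomial: index \<open>m\<close> stands for the power
  \<open>m - 1\<close>.\<close>

definition wt :: "nat list \<Rightarrow> nat" where
  "wt xs = (\<Sum>m\<leftarrow>xs. m - 1)"

lemma wt_simps [simp]: "wt [] = 0" "wt (x # xs) = (x - 1) + wt xs" "wt (xs @ ys) = wt xs + wt ys"
    "wt (rev xs) = wt xs"
  by (simp_all add: wt_def rev_map[symmetric])

lemma wt_replicate_1 [simp]: "wt (replicate n (Suc 0)) = 0"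
  by (induction n) simp_all

lemma finite_idx [simp]: "finite (idx n p)"
proof -
  have "idx n p = {xs. set xs \<subseteq> {1..p} \<and> length xs = n}" by (auto simp: idx_def)
  then show ?thesis using finite_lists_length_eq[of "{1..p}" n] by simp
qed

lemma idx_0 [simp]: "idx 0 p = {[]}"
  by (auto simp: idx_def)

lemma length_idx: "xs \<in> idx n p \<Longrightarrow> length xs = n"
  by (simp add: idx_def)

lemma idx_append: "xs \<in> idx m p \<Longrightarrow> ys \<in> idx n p \<Longrightarrow> xs @ ys \<in> idx (m + n) p"
  by (auto simp: idx_def)

lemma idx_append_le: "k \<le> d \<Longrightarrow> xs \<in> idx k p \<Longrightarrow> ys \<in> idx (d - k) p \<Longrightarrow> xs @ ys \<in> idx d p"
  using idx_append[of xs k p ys "d - k"] by simp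

lemma idx_Cons: "i \<in> {1..p} \<Longrightarrow> xs \<in> idx n p \<Longrightarrow> i # xs \<in> idx (Suc n) p"
  by (auto simp: idx_def)

lemma idx_snoc: "i \<in> {1..p} \<Longrightarrow> xs \<in> idx n p \<Longrightarrow> xs @ [i] \<in> idx (Suc n) p"
  by (auto simp: idx_def)

lemma idx_rev [simp]: "rev xs \<in> idx n p \<longleftrightarrow> xs \<in> idx n p"
  by (auto simp: idx_def)

lemma idx_replicate: "1 \<le> p \<Longrightarrow> replicate n (Suc 0) \<in> idx n p"
  by (auto simp: idx_def)

lemma idx_SucE:
  assumes "xs \<in> idx (Suc n) p"
  obtains ys i where "xs = ys @ [i]" "ys \<in> idx n p" "i \<in> {1..p}"
  using assms by (cases xs rule: rev_cases) (auto simp: idx_def)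

lemma idx_split:
  assumes "is \<in> idx d p" "k \<le> d"
  obtains xs ys where "is = xs @ ys" "xs \<in> idx k p" "ys \<in> idx (d - k) p"
proof
  show "is = take k is @ drop k is" by simp
  show "take k is \<in> idx k p" "drop k is \<in> idx (d - k) p"
    using assms set_take_subset[of k "is"] set_drop_subset[of k "is"] by (auto simp: idx_def)
qed

lemma wt_eq_0:
  assumes "xs \<in> idx n p" "wt xs = 0"
  shows "xs = replicate n (Suc 0)"
proof (rule replicate_eqI)
  show "length xs = n" using assms by (simp add: idx_def)
  fix y assume "y \<in> set xs"
  then have "y - 1 = 0" using assms(2) by (auto simp: wt_def)
  moreover have "1 \<le> y" using assms(1) \<open>y \<in> set xs\<close> by (auto simp: idx_def)
  ultimately show "y = Suc 0" by simp
qed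

lemma sum_idx_Suc:
  "(\<Sum>xs\<in>idx (Suc n) p. f xs) = (\<Sum>xs\<in>idx n p. \<Sum>i=1..p. f (xs @ [i]))"
proof -
  have "(\<Sum>xs\<in>idx n p. \<Sum>i=1..p. f (xs @ [i])) = (\<Sum>(xs, i)\<in>idx n p \<times> {1..p}. f (xs @ [i]))"
    by (simp add: sum.cartesian_product)
  also have "\<dots> = (\<Sum>xs\<in>idx (Suc n) p. f xs)"
    by (rule sum.reindex_bij_witness[where i = "\<lambda>xs. (butlast xs, last xs)" and j = "\<lambda>(xs, i). xs @ [i]"])
      (auto elim!: idx_SucE intro: idx_snoc)
  finally show ?thesis by simp
qed

text \<open>Each Kronecker summand is diagonal with the exponent of the \<open>m\<close>-th variable
  as entry, and the exponents add up to the degree.\<close>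

lemma deg_op_eq:
  assumes "is \<in> idx n p"
  shows "deg_op n p x is = real (wt is) * x is"
proof -
  have len: "length is = n" using assms by (simp add: idx_def)
  have kr: "kron (replicate (m - 1) mat_I @ [mat_N] @ replicate (n - m) mat_I) is js =
      (if is = js then real (is ! (m - 1)) - 1 else 0)"
    if m: "m \<in> {1..n}" and js: "length js = n" for m js
  proof -
    define A where "A = replicate (m - 1) mat_I @ [mat_N] @ replicate (n - m) mat_I"
    have A1: "length A = n" using that by (simp add: A_def)
    have A2: "A ! q = (if q = m - 1 then mat_N else mat_I)" if "q < n" for q
    proof -
      consider "q < m - 1" | "q = m - 1" | "m \<le> q" by linarith
      then show ?thesis
      proof cases
        case 3
        then have "q - (m - 1) = Suc (q - m)" using \<open>m \<in> {1..n}\<close> by auto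
        then show ?thesis using 3 that \<open>m \<in> {1..n}\<close> by (auto simp: A_def nth_append)
      qed (simp_all add: A_def nth_append)
    qed
    have "kron A is js = (if is = js then real (is ! (m - 1)) - 1 else 0)"
    proof (cases "is = js")
      case True
      have "kron A is js = (\<Prod>q<n. if q = m - 1 then real (is ! (m - 1)) - 1 else 1)"
        unfolding kron_def A1 by (intro prod.cong) (auto simp: A2 True mat_I_def mat_N_def)
      also have "\<dots> = real (is ! (m - 1)) - 1"
        using that by (subst prod.delta) auto
      finally show ?thesis using True by simp
    next
      case False
      then have "\<exists>q<n. is ! q \<noteq> js ! q"
        by (simp add: list_eq_iff_nth_eq len js)
      then obtain q where "q < n" "is ! q \<noteq> js ! q" by (elim exE conjE)
      then have "kron A is js = 0"
        unfolding kron_def A1 by (intro prod_zero) (auto simp: A2 mat_I_def mat_N_def)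
      then show ?thesis using False by simp
    qed
    then show ?thesis by (simp only: A_def)
  qed
  have "deg_op n p x is = (\<Sum>js\<in>idx n p. if is = js then (\<Sum>m=1..n. real (is ! (m - 1)) - 1) * x js else 0)"
    unfolding deg_op_def
  proof (intro sum.cong refl)
    fix js assume "js \<in> idx n p"
    then have "(\<Sum>m=1..n. kron (replicate (m - 1) mat_I @ [mat_N] @ replicate (n - m) mat_I) is js) =
        (\<Sum>m=1..n. if is = js then real (is ! (m - 1)) - 1 else 0)"
      by (intro sum.cong refl kr length_idx)
    then show "(\<Sum>m=1..n. kron (replicate (m - 1) mat_I @ [mat_N] @ replicate (n - m) mat_I) is js) * x js =
        (if is = js then (\<Sum>m=1..n. real (is ! (m - 1)) - 1) * x js else 0)"
      by (simp only:) simp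
  qed
  also have "\<dots> = (\<Sum>m=1..n. real (is ! (m - 1)) - 1) * x is"
    using assms by simp
  also have "(\<Sum>m=1..n. real (is ! (m - 1)) - 1) = (\<Sum>m<n. real (is ! m) - 1)"
    by (rule sum.reindex_bij_witness[where i = Suc and j = "\<lambda>m. m - 1"]) auto
  \<comment> \<open>Entries of an index list are at least 1, so truncated and real subtraction
    agree.\<close>
  also have "\<dots> = (\<Sum>m<n. real (is ! m - 1))"
  proof (intro sum.cong refl)
    fix m assume "m \<in> {..<n}"
    then have "is ! m \<in> {1..p}" using assms by (auto simp: idx_def subset_iff)
    then show "real (is ! m) - 1 = real (is ! m - 1)" by auto
  qed
  also have "\<dots> = real (wt is)"
    by (simp add: wt_def sum_list_sum_nth len atLeast0LessThan)
  finally show ?thesis .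
qed

text \<open>An eigenvalue equation of a diagonal operator is a condition on the support; homogeneity
  is used in this form from here on.\<close>

lemma homogeneous_iff: "homogeneous n p h x \<longleftrightarrow> (\<forall>is\<in>idx n p. x is \<noteq> 0 \<longrightarrow> wt is = h)"
  by (auto simp: homogeneous_def deg_op_eq)


section \<open>Segments of tensor trains\<close>

text \<open>The right end index is fixed to \<open>l'\<close>, so it can be deleted from the index
  functions and the last component splits off. The case \<open>b = a\<close> of a single component
  is included.\<close>

lemma tt_segment_eq:
  assumes "a \<le> b"
  shows "tt_segment C r a (Suc b) l l' is =
    (\<Sum>j \<in> PiE {a..b} (\<lambda>q. if q = a then {l} else {1..r q}).
      (\<Prod>q\<in>{a<..b}. C q (j (q - 1)) (is ! (q - a - 1)) (j q)) * C (Suc b) (j b) (is ! (b - a)) l')"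
proof -
  let ?F = "\<lambda>q. if q = a then {l} else {1..r q}"
  let ?G = "\<lambda>q. if q = a then {l} else if q = Suc b then {l'} else {1..r q}"
  have "PiE {a..Suc b} ?G = PiE (insert (Suc b) {a..b}) ?G"
    using assms by (intro arg_cong2[of _ _ _ _ PiE]) auto
  also have "\<dots> = (\<lambda>f. f(Suc b := l')) ` PiE {a..b} ?F"
  proof -
    have "PiE {a..b} ?G = PiE {a..b} ?F" by (intro PiE_cong) auto
    then show ?thesis using assms by (auto simp: PiE_insert_eq)
  qed
  finally have P: "PiE {a..Suc b} ?G = (\<lambda>f. f(Suc b := l')) ` PiE {a..b} ?F" .
  have inj: "inj_on (\<lambda>f. f(Suc b := l')) (PiE {a..b} ?F)"
  proof (rule inj_onI)
    fix f f' assume *: "f \<in> PiE {a..b} ?F" "f' \<in> PiE {a..b} ?F" "f(Suc b := l') = f'(Suc b := l')"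
    show "f = f'"
    proof (rule PiE_ext[OF *(1,2)])
      fix i assume "i \<in> {a..b}"
      then show "f i = f' i" using fun_cong[OF *(3), of i] by (auto split: if_splits)
    qed
  qed
  have I: "{a<..Suc b} = insert (Suc b) {a<..b}" using assms by auto
  show ?thesis
    unfolding tt_segment_def P sum.reindex[OF inj] comp_def I
    using assms by (intro sum.cong refl) (auto simp: mult.commute Suc_diff_le intro!: prod.cong)
qed

lemma tt_segment_single: "tt_segment C r a (Suc a) l l' is = C (Suc a) l (is ! 0) l'"
proof -
  have "PiE {a..a} (\<lambda>q. if q = a then {l} else {1..r q}) = {\<lambda>q. if q = a then l else undefined}"
    by (auto simp: PiE_def extensional_def fun_eq_iff Pi_def)
  then show ?thesis by (simp add: tt_segment_eq)
qed

lemma tt_segment_cong: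
  assumes "\<And>q. q < b - a \<Longrightarrow> is ! q = is' ! q"
  shows "tt_segment C r a b l l' is = tt_segment C r a b l l' is'"
  unfolding tt_segment_def using assms by (intro sum.cong prod.cong refl) auto

lemma tt_segment_Suc:
  assumes "a < b"
  shows "tt_segment C r a (Suc b) l l' is =
    (\<Sum>j=1..r b. tt_segment C r a b l j is * C (Suc b) j (is ! (b - a)) l')"
proof -
  obtain b' where b: "b = Suc b'" and b': "a \<le> b'" using assms by (cases b) auto
  let ?F = "\<lambda>q. if q = a then {l} else {1..r q}"
  let ?t = "\<lambda>f. (\<Prod>q\<in>{a<..b}. C q (f (q - 1)) (is ! (q - a - 1)) (f q)) * C (Suc b) (f b) (is ! (b - a)) l'"
  have "{a..b} = insert b {a..b'}" using b b' by auto
  then have P: "PiE {a..b} ?F = (\<lambda>(j, f). f(b := j)) ` ({1..r b} \<times> PiE {a..b'} ?F)"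
    using assms by (simp add: PiE_insert_eq)
  have inj: "inj_on (\<lambda>(j, f). f(b := j)) ({1..r b} \<times> PiE {a..b'} ?F)"
  proof (rule inj_onI, clarify)
    fix j f j' f' assume *: "f \<in> PiE {a..b'} ?F" "f' \<in> PiE {a..b'} ?F" "f(b := j) = f'(b := j')"
    have "f = f'"
    proof (rule PiE_ext[OF *(1,2)])
      fix i assume "i \<in> {a..b'}"
      then show "f i = f' i" using fun_cong[OF *(3), of i] b by (auto split: if_splits)
    qed
    moreover have "j = j'" using fun_cong[OF *(3), of b] by simp
    ultimately show "j = j' \<and> f = f'" by simp
  qed
  have I: "{a<..b} = insert b {a<..b'}" using b b' by auto
  have t: "?t (f(b := j)) = (\<Prod>q\<in>{a<..b'}. C q (f (q - 1)) (is ! (q - a - 1)) (f q)) *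
        C b (f b') (is ! (b' - a)) j * C (Suc b) j (is ! (b - a)) l'" for f j
  proof -
    have "(\<Prod>q\<in>{a<..b'}. C q ((f(b := j)) (q - 1)) (is ! (q - a - 1)) ((f(b := j)) q)) =
        (\<Prod>q\<in>{a<..b'}. C q (f (q - 1)) (is ! (q - a - 1)) (f q))"
      using b by (intro prod.cong refl) auto
    then show ?thesis
      unfolding I using b b' by (simp add: mult.commute Suc_diff_le)
  qed
  have "tt_segment C r a (Suc b) l l' is = (\<Sum>f\<in>PiE {a..b} ?F. ?t f)"
    using assms by (intro tt_segment_eq) simp
  also have "\<dots> = (\<Sum>(j, f)\<in>{1..r b} \<times> PiE {a..b'} ?F. ?t (f(b := j)))"
    unfolding P sum.reindex[OF inj] by (intro sum.cong) auto
  also have "\<dots> = (\<Sum>j=1..r b. \<Sum>f\<in>PiE {a..b'} ?F. ?t (f(b := j)))"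
    by (rule sum.cartesian_product[symmetric])
  also have "\<dots> = (\<Sum>j=1..r b. tt_segment C r a b l j is * C (Suc b) j (is ! (b - a)) l')"
    unfolding t unfolding b tt_segment_eq[OF b'] by (simp add: sum_distrib_right)
  finally show ?thesis .
qed

lemma tt_segment_snoc:
  assumes "a < b" "length xs = b - a"
  shows "tt_segment C r a (Suc b) l l' (xs @ [i]) =
    (\<Sum>j=1..r b. tt_segment C r a b l j xs * C (Suc b) j i l')"
proof -
  have "tt_segment C r a b l j (xs @ [i]) = tt_segment C r a b l j xs" for j
    using assms by (intro tt_segment_cong) (simp add: nth_append)
  then show ?thesis using assms by (simp add: tt_segment_Suc nth_append)
qed

text \<open>Associativity of the matrix products behind a train, by induction on the length of the
  right segment.\<close>

lemma tt_segment_append: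
  assumes "a < k" "k < b" "length xs = k - a" "length ys = b - k"
  shows "tt_segment C r a b l l' (xs @ ys) =
    (\<Sum>j=1..r k. tt_segment C r a k l j xs * tt_segment C r k b j l' ys)"
  using assms(2,4)
proof (induction "b - k" arbitrary: b ys l')
  case (Suc n)
  then obtain zs i where ys: "ys = zs @ [i]" by (cases ys rule: rev_cases) auto
  obtain b' where b: "b = Suc b'" using Suc.prems by (cases b) auto
  show ?case
  proof (cases "k = b'")
    case True
    then show ?thesis using Suc.prems assms ys b
      by (auto simp: tt_segment_snoc tt_segment_single)
  next
    case False
    then have kb: "k < b'" and zs: "length zs = b' - k" "n = b' - k"
      using Suc.prems Suc.hyps ys b by auto
    have "tt_segment C r a b l l' (xs @ ys) =
        (\<Sum>i'=1..r b'. (\<Sum>j=1..r k. tt_segment C r a k l j xs * tt_segment C r k b' j i' zs) * C b i' i l')"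
      using tt_segment_snoc[of a b' "xs @ zs" C r l l' i] Suc.hyps(1)[of b' zs] kb zs assms
      by (simp add: b ys)
    also have "\<dots> = (\<Sum>j=1..r k. tt_segment C r a k l j xs *
        (\<Sum>i'=1..r b'. tt_segment C r k b' j i' zs * C b i' i l'))"
      unfolding sum_distrib_left sum_distrib_right by (subst sum.swap) (simp add: mult.assoc)
    finally show ?thesis using kb zs by (simp add: b ys tt_segment_snoc)
  qed
qed simp

section \<open>Reversed tensor trains\<close>

definition rev_components :: "nat \<Rightarrow> components \<Rightarrow> components" where
  "rev_components d C q l m l' = C (Suc d - q) l' m l"

text \<open>The transpose of a product is the product of the transposes in reverse order. A position
  \<open>q\<close> between components becomes \<open>d - q\<close>, whereas component
  \<open>q\<close> becomes component \<open>d + 1 - q\<close>.\<close>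

lemma tt_segment_rev:
  assumes "a < b" "b \<le> d" "length xs = b - a"
  shows "tt_segment (rev_components d C) (\<lambda>q. r (d - q)) a b l l' xs =
    tt_segment C r (d - b) (d - a) l' l (rev xs)"
  using assms
proof (induction "b - a" arbitrary: b xs l')
  case (Suc n)
  then obtain zs i where xs: "xs = zs @ [i]" by (cases xs rule: rev_cases) auto
  obtain b' where b: "b = Suc b'" using Suc.prems by (cases b) auto
  show ?case
  proof (cases "a = b'")
    case True
    have "d - a = Suc (d - Suc a)" using Suc.prems True b by simp
    then show ?thesis using Suc.prems xs b True
      by (auto simp: tt_segment_single rev_components_def)
  next
    case False
    then have ab: "a < b'" and zs: "length zs = b' - a" "n = b' - a"
      using Suc.prems Suc.hyps xs b by auto
    have "tt_segment (rev_components d C) (\<lambda>q. r (d - q)) a b l l' xs =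
        (\<Sum>j=1..r (d - b'). tt_segment C r (d - b') (d - a) j l (rev zs) * C (d - b') l' i j)"
      using Suc.hyps(1)[of b' zs] Suc.prems ab zs
      by (simp add: b xs tt_segment_snoc rev_components_def)
    moreover have "tt_segment C r (d - b) (d - a) l' l ([i] @ rev zs) =
        (\<Sum>j=1..r (d - b'). tt_segment C r (d - b) (d - b') l' j [i] * tt_segment C r (d - b') (d - a) j l (rev zs))"
      using Suc.prems ab zs b by (intro tt_segment_append) auto
    moreover have "tt_segment C r (d - b) (d - b') l' j [i] = C (d - b') l' i j" for j
    proof -
      have "d - b' = Suc (d - b)" using Suc.prems b by simp
      then show ?thesis by (simp add: tt_segment_single)
    qed
    ultimately show ?thesis by (simp add: xs mult.commute)
  qed
qed simp


section \<open>Left orthogonal forms\<close>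

text \<open>The empty segment has one index function and an empty product, so recursions over
  \<open>k\<close> can start at 0.\<close>

lemma left_interface_0: "left_interface C r 0 (Suc 0) [] = 1"
proof -
  have "PiE {0..0} (\<lambda>q. if q = 0 then {Suc 0} else if q = 0 then {Suc 0} else {1..r q}) =
      {\<lambda>q. if q = (0::nat) then Suc 0 else undefined}"
    by (auto simp: PiE_def extensional_def fun_eq_iff Pi_def)
  then show ?thesis by (simp add: left_interface_def tt_segment_def)
qed

lemma left_interface_snoc:
  assumes "r 0 = 1" "length xs = k"
  shows "left_interface C r (Suc k) l (xs @ [i]) =
    (\<Sum>j=1..r k. left_interface C r k j xs * C (Suc k) j i l)"
proof (cases "k = 0")
  case True
  then show ?thesis using assms left_interface_0[of C r]
    by (simp add: left_interface_def tt_segment_single)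
next
  case False
  then show ?thesis using assms by (simp add: left_interface_def tt_segment_snoc)
qed

text \<open>For a fixed last index the \<open>v l\<close> are combinations of the orthonormal
  \<open>u j\<close>, so inner products can be taken on coefficients. The Gram matrix thus becomes
  the contraction in the definition of left orthogonality.\<close>

lemma ip_snoc:
  fixes n :: nat
  assumes on: "orthonormal (idx k p) {1..n} u"
    and v: "\<And>l xs i. l \<in> L \<Longrightarrow> xs \<in> idx k p \<Longrightarrow> i \<in> {1..p} \<Longrightarrow> v l (xs @ [i]) = (\<Sum>j=1..n. u j xs * A j i l)"
    and "l \<in> L" "l' \<in> L"
  shows "ip (idx (Suc k) p) (v l) (v l') = (\<Sum>j=1..n. \<Sum>m=1..p. A j m l * A j m l')"
proof -
  have "ip (idx (Suc k) p) (v l) (v l') =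
      (\<Sum>m=1..p. ip (idx k p) (\<lambda>xs. v l (xs @ [m])) (\<lambda>xs. v l' (xs @ [m])))"
    unfolding ip_def sum_idx_Suc by (rule sum.swap)
  also have "\<dots> = (\<Sum>m=1..p. \<Sum>j=1..n. A j m l * A j m l')"
  proof (intro sum.cong refl)
    fix m assume m: "m \<in> {1..p}"
    let ?t = "\<lambda>xs. \<Sum>j=1..n. u j xs * A j m l"
    have "ip (idx k p) (\<lambda>xs. v l (xs @ [m])) (\<lambda>xs. v l' (xs @ [m])) =
        ip (idx k p) ?t (\<lambda>xs. \<Sum>j=1..n. u j xs * A j m l')"
      using m assms(3,4) by (intro ip_cong v)
    also have "\<dots> = (\<Sum>j=1..n. ip (idx k p) ?t (u j) * A j m l')"
      by (rule ip_sum_right)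
    also have "\<dots> = (\<Sum>j=1..n. ip (idx k p) (u j) ?t * A j m l')"
      by (intro sum.cong refl arg_cong2[of _ _ _ _ "(*)"] ip_commute)
    also have "\<dots> = (\<Sum>j=1..n. A j m l * A j m l')"
      using orthonormal_coeff[OF on finite_atLeastAtMost] by (intro sum.cong refl) simp
    finally show "ip (idx k p) (\<lambda>xs. v l (xs @ [m])) (\<lambda>xs. v l' (xs @ [m])) =
        (\<Sum>j=1..n. A j m l * A j m l')" .
  qed
  also have "\<dots> = (\<Sum>j=1..n. \<Sum>m=1..p. A j m l * A j m l')"
    by (rule sum.swap)
  finally show ?thesis .
qed

lemma left_interface_orthonormal:
  assumes "left_orthogonal d p r C" "r 0 = 1" "k < d"
  shows "orthonormal (idx k p) {1..r k} (left_interface C r k)"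
  using assms(3)
proof (induction k)
  case 0
  show ?case using assms(2) left_interface_0[of C r] by (simp add: orthonormal_def ip_def)
next
  case (Suc k)
  then have on: "orthonormal (idx k p) {1..r k} (left_interface C r k)" by simp
  show ?case unfolding orthonormal_def
  proof (intro ballI)
    fix l l' assume l: "l \<in> {1..r (Suc k)}" "l' \<in> {1..r (Suc k)}"
    have "ip (idx (Suc k) p) (left_interface C r (Suc k) l) (left_interface C r (Suc k) l') =
        (\<Sum>j=1..r k. \<Sum>m=1..p. C (Suc k) j m l * C (Suc k) j m l')"
      using assms(2) by (intro ip_snoc[OF on, of UNIV]) (simp_all add: left_interface_snoc length_idx)
    also have "\<dots> = mat_I l l'"
      using assms(1) Suc.prems l unfolding left_orthogonal_def by fastforce
    finally show "ip (idx (Suc k) p) (left_interface C r (Suc k) l) (left_interface C r (Suc k) l') =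
        (if l = l' then 1 else 0)" by (simp add: mat_I_def)
  qed
qed

lemma orthonormal_nonzero:
  assumes "orthonormal X I q" "i \<in> I"
  obtains x where "x \<in> X" "q i x \<noteq> 0"
proof -
  have "ip X (q i) (q i) \<noteq> 0" using assms by (simp add: orthonormal_def)
  then obtain x where "x \<in> X" "q i x * q i x \<noteq> 0"
    unfolding ip_def by (rule sum.not_neutral_contains_not_neutral)
  then show ?thesis using that by auto
qed

text \<open>Turns a chain of orthonormal bases \<open>u k\<close> into a train that has them as left
  interface vectors. It suffices that the slices of \<open>u (Suc k)\<close> in the last index lie
  in the span of \<open>u k\<close>; the components are the coefficients.\<close>

lemma left_form_of_frame:
  assumes r0: "r 0 = 1" and rd: "r d = 1"
    and on: "\<And>k. k < d \<Longrightarrow> orthonormal (idx k p) {1..r k} (u k)"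
    and hom: "\<And>k l. k \<le> d \<Longrightarrow> l \<in> {1..r k} \<Longrightarrow> homogeneous k p (deg k l) (u k l)"
    and span: "\<And>k. k < d \<Longrightarrow> \<exists>A. \<forall>l\<in>{1..r (Suc k)}. \<forall>xs\<in>idx k p. \<forall>i\<in>{1..p}.
      u (Suc k) l (xs @ [i]) = (\<Sum>j=1..r k. u k j xs * A j i l)"
    and deg: "\<And>k l. k \<le> d \<Longrightarrow> l \<in> {1..r k} \<Longrightarrow> deg k l \<le> g"
    and u0: "u 0 1 [] = 1"
  shows "\<exists>C. tt_represents d p r C (u d 1) \<and> left_orthogonal d p r C \<and>
    block_sparse d p g r (\<lambda>k h. {l\<in>{1..r k}. deg k l = h}) C \<and>
    (\<forall>k\<le>d. \<forall>l\<in>{1..r k}. homogeneous k p (deg k l) (left_interface C r k l))"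
proof -
  \<comment> \<open>Inner products with an orthonormal family are the coefficients of any expansion
    in it, so they agree with the \<open>A\<close> provided by \<open>span\<close>.\<close>
  define C where "C k j m l = ip (idx (k - 1) p) (u (k - 1) j) (\<lambda>xs. u k l (xs @ [m]))" for k j m l
  have step: "u (Suc k) l (xs @ [i]) = (\<Sum>j=1..r k. u k j xs * C (Suc k) j i l)"
    if k: "k < d" and l: "l \<in> {1..r (Suc k)}" and xs: "xs \<in> idx k p" and i: "i \<in> {1..p}" for k l xs i
  proof -
    obtain A where A: "\<forall>l\<in>{1..r (Suc k)}. \<forall>xs\<in>idx k p. \<forall>i\<in>{1..p}.
      u (Suc k) l (xs @ [i]) = (\<Sum>j=1..r k. u k j xs * A j i l)" using span[OF k] by (elim exE)
    have "C (Suc k) j i l = A j i l" if "j \<in> {1..r k}" for j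
    proof -
      have "C (Suc k) j i l = ip (idx k p) (u k j) (\<lambda>xs. \<Sum>j=1..r k. u k j xs * A j i l)"
        unfolding C_def diff_Suc_1 using A l i by (intro ip_cong) auto
      also have "\<dots> = A j i l" using orthonormal_coeff[OF on[OF k] _ that] by simp
      finally show ?thesis .
    qed
    then have "(\<Sum>j=1..r k. u k j xs * C (Suc k) j i l) = (\<Sum>j=1..r k. u k j xs * A j i l)"
      by (intro sum.cong refl) simp
    then show ?thesis using A l xs i by simp
  qed
  have li: "left_interface C r k l xs = u k l xs" if "k \<le> d" "l \<in> {1..r k}" "xs \<in> idx k p" for k l xs
    using that
  proof (induction k arbitrary: l xs)
    case 0
    then show ?case using r0 u0 left_interface_0[of C r] by simp
  next
    case (Suc k)
    obtain ys i where xs: "xs = ys @ [i]" "ys \<in> idx k p" "i \<in> {1..p}"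
      using Suc.prems(3) by (rule idx_SucE)
    have "left_interface C r (Suc k) l xs = (\<Sum>j=1..r k. u k j ys * C (Suc k) j i l)"
      unfolding xs(1) left_interface_snoc[of r ys k, OF r0 length_idx[OF xs(2)]]
      using Suc.prems xs by (intro sum.cong refl arg_cong2[of _ _ _ _ "(*)"] Suc.IH) auto
    then show ?case using step[of k l ys i] Suc.prems xs by simp
  qed
  have "tt_represents d p r C (u d 1)"
    unfolding tt_represents_def using r0 rd li[of d 1] by (simp add: left_interface_def)
  moreover have "left_orthogonal d p r C"
    unfolding left_orthogonal_def
  proof (intro ballI)
    fix k l l' assume k: "k \<in> {1..<d}" and l: "l \<in> {1..r k}" "l' \<in> {1..r k}"
    then obtain k' where k': "k = Suc k'" by (cases k) auto
    have "(\<Sum>j=1..r k'. \<Sum>m=1..p. C (Suc k') j m l * C (Suc k') j m l') =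
        ip (idx (Suc k') p) (u (Suc k') l) (u (Suc k') l')"
      using k k' l step[of k'] on[of k'] by (intro ip_snoc[symmetric, of _ _ _ _ "{1..r k}"]) auto
    then show "(\<Sum>j=1..r (k - 1). \<Sum>m=1..p. C k j m l * C k j m l') = mat_I l l'"
      using on[of k] k k' l by (simp add: orthonormal_def mat_I_def)
  qed
  moreover have "block_sparse d p g r (\<lambda>k h. {l\<in>{1..r k}. deg k l = h}) C"
    unfolding block_sparse_def
  proof (intro ballI impI)
    fix k l1 m l2
    assume k: "k \<in> {1..d}" and l: "l1 \<in> {1..r (k - 1)}" "l2 \<in> {1..r k}" and m: "m \<in> {1..p}"
      and nz: "C k l1 m l2 \<noteq> 0"
    \<comment> \<open>A nonzero inner product has a nonzero term, so both vectors are nonzero at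
      some \<open>xs\<close>; their degrees then differ by \<open>m - 1\<close>.\<close>
    from nz obtain xs where xs: "xs \<in> idx (k - 1) p" and "u (k - 1) l1 xs * u k l2 (xs @ [m]) \<noteq> 0"
      unfolding C_def ip_def by (rule sum.not_neutral_contains_not_neutral)
    then have nz: "u (k - 1) l1 xs \<noteq> 0" "u k l2 (xs @ [m]) \<noteq> 0" by auto
    have "wt xs = deg (k - 1) l1"
      using hom[of "k - 1" l1] k l xs nz by (auto simp: homogeneous_iff)
    moreover have "xs @ [m] \<in> idx k p" using idx_snoc[OF m xs] k by simp
    then have "wt (xs @ [m]) = deg k l2"
      using hom[of k l2] k l nz by (auto simp: homogeneous_iff)
    moreover have "deg k l2 \<le> g" using deg k l by simp
    ultimately show "\<exists>h. h + (m - 1) \<le> g \<and> l1 \<in> {l\<in>{1..r (k - 1)}. deg (k - 1) l = h} \<and>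
        l2 \<in> {l\<in>{1..r k}. deg k l = h + (m - 1)}"
      using l by auto
  qed
  moreover have "homogeneous k p (deg k l) (left_interface C r k l)" if "k \<le> d" "l \<in> {1..r k}" for k l
    using hom[OF that] li[OF that] by (simp add: homogeneous_iff)
  ultimately show ?thesis by (intro exI[of _ C]) auto
qed

section \<open>Left orthogonal trains with prescribed blocks\<close>

definition hom_idx :: "nat \<Rightarrow> nat \<Rightarrow> nat \<Rightarrow> nat list set" where
  "hom_idx n p h = {xs\<in>idx n p. wt xs = h}"

definition block_rank :: "nat \<Rightarrow> nat \<Rightarrow> nat \<Rightarrow> tensor \<Rightarrow> nat \<Rightarrow> nat \<Rightarrow> nat" where
  "block_rank d p g e k h =
     mrank (hom_idx k p h) (hom_idx (d - k) p (g - h)) (\<lambda>xs ys. e (xs @ ys))"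

lemma finite_hom_idx [simp]: "finite (hom_idx n p h)"
  by (simp add: hom_idx_def)

text \<open>Orthonormal bases of the blocks, extended by zero to all degrees, form one family in
  which \<open>deg l\<close> names the block of vector \<open>l\<close>. Vectors of different blocks
  have disjoint supports, and the family describes the whole unfolding because \<open>e\<close>
  vanishes outside its blocks.\<close>

lemma graded_basis:
  fixes R :: nat
  assumes k: "k \<le> d" and e: "homogeneous d p g e"
    and deg: "\<And>l. l \<in> {1..R} \<Longrightarrow> deg l \<le> g"
    and card: "\<And>h. h \<le> g \<Longrightarrow> card {l\<in>{1..R}. deg l = h} = block_rank d p g e k h"
  shows "\<exists>u w b. orthonormal (idx k p) {1..R} u \<and>
    (\<forall>l\<in>{1..R}. homogeneous k p (deg l) (u l)) \<and>
    (\<forall>xs\<in>idx k p. \<forall>zs\<in>idx (d - k) p. e (xs @ zs) = (\<Sum>l=1..R. u l xs * b l zs)) \<and>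
    (\<forall>xs\<in>idx k p. \<forall>l\<in>{1..R}. u l xs = (\<Sum>zs\<in>idx (d - k) p. e (xs @ zs) * w l zs))"
proof -
  let ?I = "\<lambda>h. {l\<in>{1..R}. deg l = h}" and ?X = "\<lambda>h. hom_idx k p h" and ?Y = "\<lambda>h. hom_idx (d - k) p (g - h)"
  have "\<forall>h. \<exists>q b w. h \<le> g \<longrightarrow> orthonormal (?X h) (?I h) q \<and>
      (\<forall>x\<in>?X h. \<forall>y\<in>?Y h. e (x @ y) = (\<Sum>i\<in>?I h. q i x * b i y)) \<and>
      (\<forall>x\<in>?X h. \<forall>i\<in>?I h. q i x = (\<Sum>y\<in>?Y h. e (x @ y) * w i y))"
    (is "\<forall>h. \<exists>q b w. ?P h q b w")
  proof
    fix h
    show "\<exists>q b w. h \<le> g \<longrightarrow> orthonormal (?X h) (?I h) q \<and>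
      (\<forall>x\<in>?X h. \<forall>y\<in>?Y h. e (x @ y) = (\<Sum>i\<in>?I h. q i x * b i y)) \<and>
      (\<forall>x\<in>?X h. \<forall>i\<in>?I h. q i x = (\<Sum>y\<in>?Y h. e (x @ y) * w i y))"
    proof (cases "h \<le> g")
      case True
      have fin: "finite (?I h)" by (rule finite_subset[of _ "{1..R}"]) auto
      show ?thesis
        by (rule mrank_orthonormal_basis[OF finite_hom_idx finite_hom_idx fin card[OF True, unfolded block_rank_def]])
          blast
    qed simp
  qed
  then obtain Q B W where "\<forall>h. ?P h (Q h) (B h) (W h)"
    unfolding choice_iff by (elim exE)
  then have Q: "\<And>h. h \<le> g \<Longrightarrow> orthonormal (?X h) (?I h) (Q h)"
    and B: "\<And>h x y. h \<le> g \<Longrightarrow> x \<in> ?X h \<Longrightarrow> y \<in> ?Y h \<Longrightarrow> e (x @ y) = (\<Sum>i\<in>?I h. Q h i x * B h i y)"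
    and W: "\<And>h x i. h \<le> g \<Longrightarrow> x \<in> ?X h \<Longrightarrow> i \<in> ?I h \<Longrightarrow> Q h i x = (\<Sum>y\<in>?Y h. e (x @ y) * W h i y)"
    by blast+
  define u where "u l xs = (if wt xs = deg l then Q (deg l) l xs else 0)" for l xs
  define b where "b l zs = (if wt zs = g - deg l then B (deg l) l zs else 0)" for l zs
  define w where "w l zs = (if wt zs = g - deg l then W (deg l) l zs else 0)" for l zs
  have e0: "e (xs @ zs) = 0" if "xs \<in> idx k p" "zs \<in> idx (d - k) p" "wt xs + wt zs \<noteq> g" for xs zs
    using e idx_append_le[OF k that(1,2)] that(3) by (auto simp: homogeneous_iff)
  have 1: "orthonormal (idx k p) {1..R} u"
    unfolding orthonormal_def
  proof (intro ballI)
    fix i j assume ij: "i \<in> {1..R}" "j \<in> {1..R}"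
    show "ip (idx k p) (u i) (u j) = (if i = j then 1 else 0)"
    proof (cases "deg i = deg j")
      case True
      have "ip (idx k p) (u i) (u j) = ip (?X (deg i)) (Q (deg i) i) (Q (deg i) j)"
        unfolding ip_def using True
        by (intro sum.mono_neutral_cong_right) (auto simp: u_def hom_idx_def)
      also have "\<dots> = (if i = j then 1 else 0)"
        using Q[OF deg[OF ij(1)]] ij True by (simp add: orthonormal_def)
      finally show ?thesis .
    next
      case False
      then have "ip (idx k p) (u i) (u j) = 0"
        unfolding ip_def by (intro sum.neutral) (auto simp: u_def)
      then show ?thesis using False by auto
    qed
  qed
  have 2: "homogeneous k p (deg l) (u l)" for l
    by (auto simp: homogeneous_iff u_def)
  have 3: "e (xs @ zs) = (\<Sum>l=1..R. u l xs * b l zs)" if "xs \<in> idx k p" "zs \<in> idx (d - k) p" for xs zs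
  proof (cases "wt xs + wt zs = g")
    case True
    then have h: "wt xs \<le> g" "wt zs = g - wt xs" by auto
    then have "e (xs @ zs) = (\<Sum>i\<in>?I (wt xs). Q (wt xs) i xs * B (wt xs) i zs)"
      using that by (intro B) (auto simp: hom_idx_def)
    also have "\<dots> = (\<Sum>l=1..R. u l xs * b l zs)"
      using h by (intro sum.mono_neutral_cong_left) (auto simp: u_def b_def)
    finally show ?thesis .
  next
    case False
    have "u l xs * b l zs = 0" if "l \<in> {1..R}" for l
      using False deg[OF that] by (auto simp: u_def b_def)
    then have "(\<Sum>l=1..R. u l xs * b l zs) = 0" by (rule sum.neutral[OF ballI])
    then show ?thesis using e0[OF that False] by simp
  qed
  have 4: "u l xs = (\<Sum>zs\<in>idx (d - k) p. e (xs @ zs) * w l zs)" if "xs \<in> idx k p" "l \<in> {1..R}" for l xs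
  proof (cases "wt xs = deg l")
    case True
    have "u l xs = (\<Sum>zs\<in>?Y (deg l). e (xs @ zs) * W (deg l) l zs)"
      using W[OF deg[OF that(2)], of xs l] that True by (simp add: u_def hom_idx_def)
    also have "\<dots> = (\<Sum>zs\<in>idx (d - k) p. e (xs @ zs) * w l zs)"
      by (intro sum.mono_neutral_cong_left) (auto simp: w_def hom_idx_def)
    finally show ?thesis .
  next
    case False
    then have "e (xs @ zs) * w l zs = 0" if "zs \<in> idx (d - k) p" for zs
      using deg[OF \<open>l \<in> {1..R}\<close>] e0[OF \<open>xs \<in> idx k p\<close> that] by (auto simp: w_def)
    then have "(\<Sum>zs\<in>idx (d - k) p. e (xs @ zs) * w l zs) = 0" by (rule sum.neutral[OF ballI])
    then show ?thesis using False by (simp add: u_def)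
  qed
  show ?thesis
    by (intro exI conjI ballI) (rule 1, rule 2, rule 3, assumption+, rule 4, assumption+)
qed

text \<open>The basis at \<open>k\<close> comes from the blocks of \<open>e k\<close>. A slice of a
  basis vector at \<open>Suc k\<close> combines columns of the \<open>k\<close>-th unfolding of
  \<open>e (Suc k)\<close>; by \<open>chain\<close> these lie in the column space of that of
  \<open>e k\<close>, hence in the span of the basis at \<open>k\<close>.\<close>

lemma left_form:
  assumes "1 \<le> d" and r0: "r 0 = 1" and rd: "r d = 1"
    and deg0: "deg 0 1 = 0" and degd: "deg d 1 = g"
    and e: "\<And>k. 1 \<le> k \<Longrightarrow> k \<le> d \<Longrightarrow> homogeneous d p g (e k)"
    and chain: "\<And>k. 1 \<le> k \<Longrightarrow> k < d \<Longrightarrow> \<exists>T. \<forall>xs\<in>idx k p. \<forall>zs\<in>idx (d - k) p.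
      e (Suc k) (xs @ zs) = (\<Sum>ys\<in>idx (d - k) p. e k (xs @ ys) * T ys zs)"
    and deg: "\<And>k l. 1 \<le> k \<Longrightarrow> k < d \<Longrightarrow> l \<in> {1..r k} \<Longrightarrow> deg k l \<le> g"
    and card: "\<And>k h. 1 \<le> k \<Longrightarrow> k < d \<Longrightarrow> h \<le> g \<Longrightarrow>
      card {l\<in>{1..r k}. deg k l = h} = block_rank d p g (e k) k h"
  shows "\<exists>C. tt_represents d p r C (e d) \<and> left_orthogonal d p r C \<and>
    block_sparse d p g r (\<lambda>k h. {l\<in>{1..r k}. deg k l = h}) C \<and>
    (\<forall>k\<le>d. \<forall>l\<in>{1..r k}. homogeneous k p (deg k l) (left_interface C r k l))"
proof -
  have "\<forall>k. \<exists>u w b. 1 \<le> k \<and> k < d \<longrightarrow> orthonormal (idx k p) {1..r k} u \<and>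
    (\<forall>l\<in>{1..r k}. homogeneous k p (deg k l) (u l)) \<and>
    (\<forall>xs\<in>idx k p. \<forall>zs\<in>idx (d - k) p. e k (xs @ zs) = (\<Sum>l=1..r k. u l xs * b l zs)) \<and>
    (\<forall>xs\<in>idx k p. \<forall>l\<in>{1..r k}. u l xs = (\<Sum>zs\<in>idx (d - k) p. e k (xs @ zs) * w l zs))"
    (is "\<forall>k. \<exists>u w b. ?P k u w b")
  proof
    fix k
    show "\<exists>u w b. ?P k u w b"
    proof (cases "1 \<le> k \<and> k < d")
      case True
      have "\<exists>u w b. orthonormal (idx k p) {1..r k} u \<and>
        (\<forall>l\<in>{1..r k}. homogeneous k p (deg k l) (u l)) \<and>
        (\<forall>xs\<in>idx k p. \<forall>zs\<in>idx (d - k) p. e k (xs @ zs) = (\<Sum>l=1..r k. u l xs * b l zs)) \<and>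
        (\<forall>xs\<in>idx k p. \<forall>l\<in>{1..r k}. u l xs = (\<Sum>zs\<in>idx (d - k) p. e k (xs @ zs) * w l zs))"
        using True by (intro graded_basis[of k d p g "e k"] e deg card) auto
      then show ?thesis by (elim exE) (intro exI impI, assumption)
    next
      case False
      then show ?thesis by (intro exI impI) (erule notE)
    qed
  qed
  then obtain U W B where "\<forall>k. ?P k (U k) (W k) (B k)"
    unfolding choice_iff by (elim exE)
  then have U1: "\<And>k. 1 \<le> k \<Longrightarrow> k < d \<Longrightarrow> orthonormal (idx k p) {1..r k} (U k)"
    and U2: "\<And>k l. 1 \<le> k \<Longrightarrow> k < d \<Longrightarrow> l \<in> {1..r k} \<Longrightarrow> homogeneous k p (deg k l) (U k l)"
    and U3: "\<And>k xs zs. 1 \<le> k \<Longrightarrow> k < d \<Longrightarrow> xs \<in> idx k p \<Longrightarrow> zs \<in> idx (d - k) p \<Longrightarrow>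
      e k (xs @ zs) = (\<Sum>l=1..r k. U k l xs * B k l zs)"
    and U4: "\<And>k xs l. 1 \<le> k \<Longrightarrow> k < d \<Longrightarrow> xs \<in> idx k p \<Longrightarrow> l \<in> {1..r k} \<Longrightarrow>
      U k l xs = (\<Sum>zs\<in>idx (d - k) p. e k (xs @ zs) * W k l zs)"
    by blast+
  \<comment> \<open>The ends carry the constant 1 and the tensor \<open>e d\<close> itself, which
    need not have norm 1.\<close>
  define u where "u k = (if k = 0 then (\<lambda>_ _. 1) else if k = d then (\<lambda>_. e d) else U k)" for k
  have expand: "\<exists>b. \<forall>xs\<in>idx k p. \<forall>zs\<in>idx (d - k) p. e (Suc k) (xs @ zs) = (\<Sum>j=1..r k. u k j xs * b j zs)"
    if "k < d" for k
  proof (cases "k = 0")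
    case True
    then show ?thesis using r0 by (intro exI[of _ "\<lambda>_ zs. e (Suc 0) zs"]) (simp add: u_def)
  next
    case False
    then have k: "1 \<le> k" by simp
    obtain T where T: "\<forall>xs\<in>idx k p. \<forall>zs\<in>idx (d - k) p.
      e (Suc k) (xs @ zs) = (\<Sum>ys\<in>idx (d - k) p. e k (xs @ ys) * T ys zs)"
      using chain[OF k \<open>k < d\<close>] by (elim exE)
    have "e (Suc k) (xs @ zs) = (\<Sum>j=1..r k. u k j xs * (\<Sum>ys\<in>idx (d - k) p. B k j ys * T ys zs))"
      if "xs \<in> idx k p" "zs \<in> idx (d - k) p" for xs zs
    proof -
      have "e (Suc k) (xs @ zs) = (\<Sum>ys\<in>idx (d - k) p. (\<Sum>l=1..r k. U k l xs * B k l ys) * T ys zs)"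
        using T U3[OF k \<open>k < d\<close> that(1)] that by simp
      also have "\<dots> = (\<Sum>j=1..r k. U k j xs * (\<Sum>ys\<in>idx (d - k) p. B k j ys * T ys zs))"
        unfolding sum_distrib_left sum_distrib_right by (subst sum.swap) (simp add: mult.assoc)
      finally show ?thesis using False \<open>k < d\<close> by (simp add: u_def)
    qed
    then show ?thesis by (intro exI ballI)
  qed
  have combine: "\<exists>w. \<forall>xs\<in>idx k p. \<forall>l\<in>{1..r k}. u k l xs = (\<Sum>zs\<in>idx (d - k) p. e k (xs @ zs) * w l zs)"
    if "1 \<le> k" "k \<le> d" for k
  proof (cases "k = d")
    case True
    then show ?thesis using \<open>1 \<le> d\<close> by (intro exI[of _ "\<lambda>_ _. 1"]) (simp add: u_def)
  next
    case False
    then show ?thesis using U4[of k] that by (intro exI[of _ "W k"]) (simp add: u_def)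
  qed
  have "\<exists>C. tt_represents d p r C (u d 1) \<and> left_orthogonal d p r C \<and>
    block_sparse d p g r (\<lambda>k h. {l\<in>{1..r k}. deg k l = h}) C \<and>
    (\<forall>k\<le>d. \<forall>l\<in>{1..r k}. homogeneous k p (deg k l) (left_interface C r k l))"
  proof (rule left_form_of_frame[OF r0 rd])
    show "orthonormal (idx k p) {1..r k} (u k)" if "k < d" for k
      using U1[of k] that r0 by (cases "k = 0") (simp_all add: u_def orthonormal_def ip_def)
    show "homogeneous k p (deg k l) (u k l)" if "k \<le> d" "l \<in> {1..r k}" for k l
    proof -
      consider "k = 0" | "k = d" "0 < k" | "1 \<le> k" "k < d" using \<open>k \<le> d\<close> by linarith
      then show ?thesis
      proof cases
        case 1
        then show ?thesis using that r0 deg0 by (simp add: homogeneous_iff)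
      next
        case 2
        then show ?thesis using that rd degd e[of d] by (simp add: u_def)
      next
        case 3
        then show ?thesis using that U2[of k l] by (simp add: u_def)
      qed
    qed
    show "deg k l \<le> g" if "k \<le> d" "l \<in> {1..r k}" for k l
    proof -
      consider "k = 0" | "k = d" | "1 \<le> k" "k < d" using \<open>k \<le> d\<close> by linarith
      then show ?thesis using that r0 deg0 rd degd deg[of k l] by cases simp_all
    qed
    show "u 0 1 [] = 1" by (simp add: u_def)
    show "\<exists>A. \<forall>l\<in>{1..r (Suc k)}. \<forall>xs\<in>idx k p. \<forall>i\<in>{1..p}.
      u (Suc k) l (xs @ [i]) = (\<Sum>j=1..r k. u k j xs * A j i l)" if k: "k < d" for k
    proof -
      obtain b where b: "\<forall>xs\<in>idx k p. \<forall>zs\<in>idx (d - k) p. e (Suc k) (xs @ zs) = (\<Sum>j=1..r k. u k j xs * b j zs)"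
        using expand[OF k] by (elim exE)
      obtain w where w: "\<forall>xs\<in>idx (Suc k) p. \<forall>l\<in>{1..r (Suc k)}.
        u (Suc k) l xs = (\<Sum>zs\<in>idx (d - Suc k) p. e (Suc k) (xs @ zs) * w l zs)"
        using combine[of "Suc k"] k by auto
      \<comment> \<open>The index \<open>i\<close> changes sides: it ends a row of the unfolding at
        \<open>Suc k\<close> and begins a column of the one at \<open>k\<close>.\<close>
      have "u (Suc k) l (xs @ [i]) = (\<Sum>j=1..r k. u k j xs * (\<Sum>zs\<in>idx (d - Suc k) p. b j (i # zs) * w l zs))"
        if "l \<in> {1..r (Suc k)}" "xs \<in> idx k p" "i \<in> {1..p}" for l xs i
      proof -
        have zs: "i # zs \<in> idx (d - k) p" if "zs \<in> idx (d - Suc k) p" for zs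
          using idx_Cons[OF \<open>i \<in> {1..p}\<close> that] k by (simp add: Suc_diff_Suc)
        have "u (Suc k) l (xs @ [i]) = (\<Sum>zs\<in>idx (d - Suc k) p. e (Suc k) ((xs @ [i]) @ zs) * w l zs)"
          using w idx_snoc[OF that(3,2)] that(1) by blast
        also have "\<dots> = (\<Sum>zs\<in>idx (d - Suc k) p. (\<Sum>j=1..r k. u k j xs * b j (i # zs)) * w l zs)"
          using b zs that(2) by (intro sum.cong refl) simp
        also have "\<dots> = (\<Sum>j=1..r k. u k j xs * (\<Sum>zs\<in>idx (d - Suc k) p. b j (i # zs) * w l zs))"
          unfolding sum_distrib_left sum_distrib_right by (subst sum.swap) (simp add: mult.assoc)
        finally show ?thesis .
      qed
      then show ?thesis by (intro exI ballI)
    qed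
  qed
  moreover have "u d 1 = e d" using \<open>1 \<le> d\<close> by (simp add: u_def)
  ultimately show ?thesis by simp
qed


section \<open>Right orthogonal forms\<close>

text \<open>
  For \<open>1 \<le> k < d\<close> the tensor \<open>e k\<close> prescribes the blocks at position \<open>k\<close>; it may change with \<open>k\<close> as
  long as the \<open>k\<close>-slices of \<open>e (Suc k)\<close> stay in the column space of the \<open>k\<close>-th unfolding of \<open>e k\<close>.
\<close>

definition nested :: "nat \<Rightarrow> nat \<Rightarrow> (nat \<Rightarrow> tensor) \<Rightarrow> bool" where
  "nested d p e \<longleftrightarrow> (\<forall>k. 1 \<le> k \<longrightarrow> k < d \<longrightarrow> (\<exists>T. \<forall>xs\<in>idx k p. \<forall>zs\<in>idx (d - k) p.
     e (Suc k) (xs @ zs) = (\<Sum>ys\<in>idx (d - k) p. e k (xs @ ys) * T ys zs)))"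

lemma homogeneous_rev: "homogeneous n p h (\<lambda>is. x (rev is)) \<longleftrightarrow> homogeneous n p h x"
proof -
  have "homogeneous n p h (\<lambda>is. y (rev is))" if "homogeneous n p h y" for y
    using that unfolding homogeneous_iff by (metis idx_rev wt_simps(4))
  from this[of x] this[of "\<lambda>is. x (rev is)"] show ?thesis by auto
qed

lemma block_rank_rev:
  assumes "k \<le> d" "h \<le> g"
  shows "block_rank d p g (\<lambda>is. e (rev is)) k h = block_rank d p g e (d - k) (g - h)"
proof (rule antisym)
  show "block_rank d p g (\<lambda>is. e (rev is)) k h \<le> block_rank d p g e (d - k) (g - h)"
    unfolding block_rank_def
    by (rule mrank_transpose_le[where f = rev and h = rev]) (use assms in \<open>auto simp: hom_idx_def\<close>)
  show "block_rank d p g e (d - k) (g - h) \<le> block_rank d p g (\<lambda>is. e (rev is)) k h"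
    unfolding block_rank_def
    by (rule mrank_transpose_le[where f = rev and h = rev]) (use assms in \<open>auto simp: hom_idx_def\<close>)
qed

text \<open>The left form of the reversed family, reversed back. Position \<open>k\<close> turns
  into \<open>d - k\<close> and degree \<open>h\<close> into \<open>g - h\<close>; the last member
  of the reversed family comes from \<open>e 0\<close>, which is therefore the tensor
  represented.\<close>

lemma right_form:
  assumes d: "1 \<le> d" and r0: "r 0 = 1" and rd: "\<And>k. d \<le> k \<Longrightarrow> r k = 1"
    and deg0: "deg 0 1 = 0" and degd: "deg d 1 = g"
    and e: "\<And>k. k < d \<Longrightarrow> homogeneous d p g (e k)"
    and nested: "nested d p (\<lambda>k is. e (d - k) (rev is))"
    and deg: "\<And>k l. 1 \<le> k \<Longrightarrow> k < d \<Longrightarrow> l \<in> {1..r k} \<Longrightarrow> deg k l \<le> g"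
    and card: "\<And>k h. 1 \<le> k \<Longrightarrow> k < d \<Longrightarrow> h \<le> g \<Longrightarrow>
      card {l\<in>{1..r k}. deg k l = h} = block_rank d p g (e k) k h"
  shows "\<exists>C. tt_represents d p r C (e 0) \<and> right_orthogonal d p r C \<and>
    block_sparse d p g r (\<lambda>k h. {l\<in>{1..r k}. deg k l = h}) C \<and>
    (\<forall>k<d. \<forall>l\<in>{1..r k}. homogeneous (d - k) p (g - deg k l) (right_interface d C r k l))"
proof -
  let ?r = "\<lambda>q. r (d - q)" and ?deg = "\<lambda>k l. g - deg (d - k) l" and ?e = "\<lambda>k is. e (d - k) (rev is)"
  \<comment> \<open>Truncated subtraction maps every \<open>q > d\<close> to the value at
    \<open>d\<close>, so \<open>r\<close> has to be 1 beyond \<open>d\<close> as well.\<close>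
  have rr: "(\<lambda>q. r (d - (d - q))) = r"
  proof
    fix q show "r (d - (d - q)) = r q" using rd[of q] rd[of d] by (cases "q \<le> d") simp_all
  qed
  \<comment> \<open>Replacing a degree by its difference to \<open>g\<close> can be undone only for
    degrees at most \<open>g\<close>.\<close>
  have degle: "deg k l \<le> g" if "k \<le> d" "l \<in> {1..r k}" for k l
  proof -
    consider "k = 0" | "k = d" | "1 \<le> k" "k < d" using \<open>k \<le> d\<close> by linarith
    then show ?thesis using that r0 deg0 rd[of d] degd deg[of k l] by cases simp_all
  qed
  have "\<exists>C. tt_represents d p ?r C (?e d) \<and> left_orthogonal d p ?r C \<and>
    block_sparse d p g ?r (\<lambda>k h. {l\<in>{1..?r k}. ?deg k l = h}) C \<and>
    (\<forall>k\<le>d. \<forall>l\<in>{1..?r k}. homogeneous k p (?deg k l) (left_interface C ?r k l))"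
  proof (rule left_form[where r = ?r and deg = ?deg and e = ?e, OF d])
    show "\<exists>T. \<forall>xs\<in>idx k p. \<forall>zs\<in>idx (d - k) p.
      ?e (Suc k) (xs @ zs) = (\<Sum>ys\<in>idx (d - k) p. ?e k (xs @ ys) * T ys zs)" if "1 \<le> k" "k < d" for k
      using nested that unfolding nested_def by blast
    show "homogeneous d p g (?e k)" if "1 \<le> k" "k \<le> d" for k
      using e[of "d - k"] that by (simp add: homogeneous_rev)
    show "card {l\<in>{1..?r k}. ?deg k l = h} = block_rank d p g (?e k) k h" if "1 \<le> k" "k < d" "h \<le> g" for k h
    proof -
      have "{l\<in>{1..?r k}. ?deg k l = h} = {l\<in>{1..r (d - k)}. deg (d - k) l = g - h}"
        using degle[of "d - k"] that by fastforce
      then show ?thesis using card[of "d - k" "g - h"] that by (simp add: block_rank_rev)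
    qed
  qed (use r0 rd[of d] deg0 degd in auto)
  then obtain C where C1: "tt_represents d p ?r C (?e d)" and C2: "left_orthogonal d p ?r C"
    and C3: "block_sparse d p g ?r (\<lambda>k h. {l\<in>{1..?r k}. ?deg k l = h}) C"
    and C4: "\<And>k l. k \<le> d \<Longrightarrow> l \<in> {1..?r k} \<Longrightarrow> homogeneous k p (?deg k l) (left_interface C ?r k l)"
    by blast
  let ?C = "rev_components d C"
  have seg: "tt_segment ?C r a d l l' xs = tt_segment C ?r 0 (d - a) l' l (rev xs)"
    if "a < d" "length xs = d - a" for a l l' xs
    using tt_segment_rev[of a d d xs C ?r l l'] that by (simp add: rr)
  have "tt_represents d p r ?C (e 0)"
    unfolding tt_represents_def
  proof (intro conjI ballI r0 rd order_refl)
    fix "is" assume i: "is \<in> idx d p"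
    have "e 0 is = ?e d (rev is)" by simp
    also have "\<dots> = tt_segment C ?r 0 d 1 1 (rev is)"
      using C1 i unfolding tt_represents_def by (meson idx_rev)
    finally show "e 0 is = tt_segment ?C r 0 d 1 1 is"
      using seg[of 0 "is"] d length_idx[OF i] by simp
  qed
  moreover have "right_orthogonal d p r ?C"
    unfolding right_orthogonal_def
  proof (intro ballI)
    fix k l l' assume k: "k \<in> {2..d}" and l: "l \<in> {1..r (k - 1)}" "l' \<in> {1..r (k - 1)}"
    \<comment> \<open>Component \<open>k\<close> of the reversed train is component
      \<open>d + 1 - k\<close> of \<open>C\<close>, which runs over \<open>1, ..., d - 1\<close> as
      \<open>k\<close> runs over \<open>2, ..., d\<close>.\<close>
    have k1: "d - (Suc d - k) = k - 1" "d - (Suc d - k - 1) = k" "Suc d - k \<in> {1..<d}" using k by auto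
    from C2 k1(3) have "\<forall>l\<in>{1..?r (Suc d - k)}. \<forall>l'\<in>{1..?r (Suc d - k)}.
        (\<Sum>j=1..?r (Suc d - k - 1). \<Sum>m=1..p. C (Suc d - k) j m l * C (Suc d - k) j m l') = mat_I l l'"
      unfolding left_orthogonal_def by (rule bspec)
    then have "(\<Sum>j=1..r k. \<Sum>m=1..p. C (Suc d - k) j m l * C (Suc d - k) j m l') = mat_I l l'"
      using l unfolding k1(1,2) by blast
    then show "(\<Sum>m=1..p. \<Sum>j=1..r k. ?C k l m j * ?C k l' m j) = mat_I l l'"
      unfolding rev_components_def by (subst sum.swap)
  qed
  moreover have "block_sparse d p g r (\<lambda>k h. {l\<in>{1..r k}. deg k l = h}) ?C"
    unfolding block_sparse_def
  proof (intro ballI impI)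
    fix k l1 m l2
    assume k: "k \<in> {1..d}" and l: "l1 \<in> {1..r (k - 1)}" "l2 \<in> {1..r k}" and m: "m \<in> {1..p}"
      and nz: "?C k l1 m l2 \<noteq> 0"
    have k1: "d - (Suc d - k) = k - 1" "d - (Suc d - k - 1) = k" "Suc d - k \<in> {1..d}" using k by auto
    have "C (Suc d - k) l2 m l1 \<noteq> 0" "l2 \<in> {1..?r (Suc d - k - 1)}" "l1 \<in> {1..?r (Suc d - k)}"
      using l nz unfolding k1 rev_components_def by simp_all
    then obtain h where h: "h + (m - 1) \<le> g" "l2 \<in> {l\<in>{1..?r (Suc d - k - 1)}. ?deg (Suc d - k - 1) l = h}"
      "l1 \<in> {l\<in>{1..?r (Suc d - k)}. ?deg (Suc d - k) l = h + (m - 1)}"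
      using C3 k1(3) m unfolding block_sparse_def by blast
    have "g - deg k l2 = h" "g - deg (k - 1) l1 = h + (m - 1)" using h(2,3) k1 by auto
    moreover have "deg k l2 \<le> g" "deg (k - 1) l1 \<le> g" using degle l k by auto
    ultimately have "deg k l2 = deg (k - 1) l1 + (m - 1)" "deg (k - 1) l1 + (m - 1) \<le> g"
      using h(1) by auto
    then show "\<exists>h. h + (m - 1) \<le> g \<and> l1 \<in> {l\<in>{1..r (k - 1)}. deg (k - 1) l = h} \<and>
        l2 \<in> {l\<in>{1..r k}. deg k l = h + (m - 1)}"
      using l by auto
  qed
  moreover have "homogeneous (d - k) p (g - deg k l) (right_interface d ?C r k l)"
    if "k < d" "l \<in> {1..r k}" for k l
  proof -
    have "homogeneous (d - k) p (g - deg k l) (\<lambda>is. left_interface C ?r (d - k) l (rev is))"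
      using C4[of "d - k" l] that by (simp add: homogeneous_rev)
    moreover have "left_interface C ?r (d - k) l (rev is) = right_interface d ?C r k l is"
      if "is \<in> idx (d - k) p" for "is"
      using seg[OF \<open>k < d\<close> length_idx[OF that]] by (simp add: left_interface_def right_interface_def)
    ultimately show ?thesis by (simp add: homogeneous_iff)
  qed
  ultimately show ?thesis by (intro exI[of _ ?C]) auto
qed

section \<open>Existence of representations with prescribed blocks\<close>

text \<open>One labelling of the rank indices by degrees serves both forms, which therefore share
  ranks and block index sets. The left form represents \<open>e d\<close> and the right form
  \<open>e 0\<close>; only these have to be \<open>c\<close>, so the inner \<open>e k\<close> may be
  padded.\<close>

lemma block_sparse_rep_exists:
  assumes d: "1 \<le> d" and e: "\<And>k. k \<le> d \<Longrightarrow> homogeneous d p g (e k)"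
    and e0: "e 0 = c" and ed: "e d = c"
    and nl: "nested d p e" and nr: "nested d p (\<lambda>k is. e (d - k) (rev is))"
  shows "\<exists>r CL CR S. block_sparse_rep d p g c r CL CR S \<and>
    (\<forall>k\<in>{1..<d}. r k = (\<Sum>h\<le>g. block_rank d p g (e k) k h) \<and>
      (\<forall>h\<le>g. card (S k h) = block_rank d p g (e k) k h))"
proof -
  define A where "A k = (SIGMA h:{..g}. {..<block_rank d p g (e k) k h})" for k
  have fin: "finite (A k)" for k by (simp add: A_def)
  have "\<forall>k. \<exists>f. bij_betw f {1..card (A k)} (A k)"
    using ex_bij_betw_nat_finite_1[OF fin] by blast
  then obtain f where f: "\<And>k. bij_betw (f k) {1..card (A k)} (A k)"
    unfolding choice_iff by blast
  define r where "r k = (if k = 0 \<or> d \<le> k then 1 else card (A k))" for k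
  define deg where "deg k l = (if k = 0 then 0 else if k = d then g else fst (f k l))" for k l
  define S where "S k h = {l\<in>{1..r k}. deg k l = h}" for k h
  have r0: "r 0 = 1" and rd: "\<And>k. d \<le> k \<Longrightarrow> r k = 1" and rd': "r d = 1"
    and deg0: "deg 0 1 = 0" and degd: "deg d 1 = g"
    using d by (auto simp: r_def deg_def)
  have deg: "deg k l \<le> g" if "1 \<le> k" "k < d" "l \<in> {1..r k}" for k l
  proof -
    have "f k l \<in> A k" using bij_betwE[OF f[of k]] that by (simp add: r_def)
    then show ?thesis using that by (auto simp: deg_def A_def)
  qed
  have card: "card {l\<in>{1..r k}. deg k l = h} = block_rank d p g (e k) k h"
    if "1 \<le> k" "k < d" "h \<le> g" for k h
  proof -
    let ?L = "{l\<in>{1..r k}. deg k l = h}"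
    have L: "?L = {l\<in>{1..card (A k)}. fst (f k l) = h}" using that by (simp add: deg_def r_def)
    have "f k ` ?L = {a \<in> f k ` {1..card (A k)}. fst a = h}"
      unfolding L by blast
    also have "f k ` {1..card (A k)} = A k"
      using f[of k] by (simp add: bij_betw_def)
    also have "{a \<in> A k. fst a = h} = {h} \<times> {..<block_rank d p g (e k) k h}" using that by (auto simp: A_def)
    finally have "card (f k ` ?L) = block_rank d p g (e k) k h" by (simp add: card_cartesian_product)
    moreover have "inj_on (f k) ?L"
      using f[of k] unfolding L bij_betw_def by (auto intro: inj_on_subset)
    ultimately show ?thesis by (simp add: card_image)
  qed
  have "\<exists>C. tt_represents d p r C (e d) \<and> left_orthogonal d p r C \<and>
    block_sparse d p g r (\<lambda>k h. {l\<in>{1..r k}. deg k l = h}) C \<and>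
    (\<forall>k\<le>d. \<forall>l\<in>{1..r k}. homogeneous k p (deg k l) (left_interface C r k l))"
    using nl unfolding nested_def by (intro left_form[where e = e] d r0 rd' deg0 degd e deg card) blast+
  then obtain CL where CL1: "tt_represents d p r CL c" and CL2: "left_orthogonal d p r CL"
    and CL3: "block_sparse d p g r S CL"
    and CL4: "\<And>k l. k \<le> d \<Longrightarrow> l \<in> {1..r k} \<Longrightarrow> homogeneous k p (deg k l) (left_interface CL r k l)"
    unfolding ed S_def[abs_def] by blast
  have "\<exists>C. tt_represents d p r C (e 0) \<and> right_orthogonal d p r C \<and>
    block_sparse d p g r (\<lambda>k h. {l\<in>{1..r k}. deg k l = h}) C \<and>
    (\<forall>k<d. \<forall>l\<in>{1..r k}. homogeneous (d - k) p (g - deg k l) (right_interface d C r k l))"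
    by (intro right_form[where e = e] d r0 rd deg0 degd e nr deg card) simp_all
  then obtain CR where CR1: "tt_represents d p r CR c" and CR2: "right_orthogonal d p r CR"
    and CR3: "block_sparse d p g r S CR"
    and CR4: "\<And>k l. k < d \<Longrightarrow> l \<in> {1..r k} \<Longrightarrow>
      homogeneous (d - k) p (g - deg k l) (right_interface d CR r k l)"
    unfolding e0 S_def[abs_def] by blast
  \<comment> \<open>The block index set must contain every \<open>l\<close> whose interface vector
    is homogeneous of degree \<open>h\<close>. These vectors have norm 1, so none is homogeneous of
    two degrees.\<close>
  have S: "S k h = {l\<in>{1..r k}. homogeneous k p h (left_interface CL r k l)}"
    if "k \<in> {1..<d}" for k h
  proof -
    have "homogeneous k p h (left_interface CL r k l) \<longleftrightarrow> deg k l = h" if l: "l \<in> {1..r k}" for l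
    proof -
      obtain x where "x \<in> idx k p" "left_interface CL r k l x \<noteq> 0"
        using orthonormal_nonzero[OF left_interface_orthonormal[OF CL2 r0] l] \<open>k \<in> {1..<d}\<close> by auto
      then show ?thesis using CL4[of k l] l \<open>k \<in> {1..<d}\<close> by (auto simp: homogeneous_iff)
    qed
    then show ?thesis by (auto simp: S_def)
  qed
  have "block_sparse_rep d p g c r CL CR S"
    unfolding block_sparse_rep_def
  proof (intro conjI ballI allI impI CL1 CL2 CL3 CR1 CR2 CR3)
    show "S k h = {l\<in>{1..r k}. homogeneous k p h (left_interface CL r k l)}" if "k \<in> {1..<d}" for k h
      by (rule S[OF that])
    show "homogeneous (d - k) p (g - h) (right_interface d CR r k l)"
      if "k \<in> {1..<d}" "l \<in> S k h" for k h l
      using CR4[of k l] that by (auto simp: S_def)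
    show "S 0 h = (if h = 0 then {1} else {})" for h
      using r0 by (auto simp: S_def deg_def)
    show "S d h = (if h = g then {1} else {})" for h
      using rd' d by (auto simp: S_def deg_def)
  qed
  moreover have "r k = (\<Sum>h\<le>g. block_rank d p g (e k) k h)" if "k \<in> {1..<d}" for k
    using that by (simp add: r_def A_def)
  moreover have "card (S k h) = block_rank d p g (e k) k h" if "k \<in> {1..<d}" "h \<le> g" for k h
    using card[of k h] that by (simp add: S_def)
  ultimately show ?thesis by blast
qed


section \<open>Padding\<close>

text \<open>For homogeneous \<open>c\<close> this says that the block of degree \<open>g\<close> at
  position \<open>k\<close> is nonzero; \<open>right_lead\<close> does the same for the block of
  degree 0.\<close>

definition left_lead :: "nat \<Rightarrow> nat \<Rightarrow> tensor \<Rightarrow> nat \<Rightarrow> bool" where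
  "left_lead d p c k \<longleftrightarrow> (\<exists>xs\<in>idx k p. c (xs @ replicate (d - k) 1) \<noteq> 0)"

definition right_lead :: "nat \<Rightarrow> nat \<Rightarrow> tensor \<Rightarrow> nat \<Rightarrow> bool" where
  "right_lead d p c k \<longleftrightarrow> (\<exists>ys\<in>idx (d - k) p. c (replicate k 1 @ ys) \<noteq> 0)"

text \<open>
  The index lists \<open>p # replicate (d - 1) 1\<close> and \<open>replicate (d - 1) 1 @ [p]\<close> stand for
  \<open>x\<^sub>1\<^sup>g\<close> and \<open>x\<^sub>d\<^sup>g\<close>.
\<close>

definition pad :: "nat \<Rightarrow> nat \<Rightarrow> tensor \<Rightarrow> nat \<Rightarrow> tensor" where
  "pad d p c k is = (if k = 0 \<or> k = d then c is else
     c is + of_bool (\<not> left_lead d p c k) * of_bool (is = p # replicate (d - 1) 1)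
          + of_bool (\<not> right_lead d p c k) * of_bool (is = replicate (d - 1) 1 @ [p]))"

lemma left_lead_rev:
  assumes "k \<le> d"
  shows "left_lead d p (\<lambda>is. c (rev is)) k \<longleftrightarrow> right_lead d p c (d - k)"
  unfolding left_lead_def right_lead_def using assms
  by (auto intro: bexI[of _ "rev _"])

lemma right_lead_rev:
  assumes "k \<le> d"
  shows "right_lead d p (\<lambda>is. c (rev is)) k \<longleftrightarrow> left_lead d p c (d - k)"
  using left_lead_rev[of "d - k" d p "\<lambda>is. c (rev is)"] assms by simp

lemma pad_rev:
  assumes "k \<le> d"
  shows "pad d p (\<lambda>is. c (rev is)) k is = pad d p c (d - k) (rev is)"
proof -
  have "is = p # replicate (d - 1) 1 \<longleftrightarrow> rev is = replicate (d - 1) 1 @ [p]"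
    "is = replicate (d - 1) 1 @ [p] \<longleftrightarrow> rev is = p # replicate (d - 1) 1"
    by (auto simp: rev_swap)
  then show ?thesis using assms by (auto simp: pad_def left_lead_rev right_lead_rev)
qed

text \<open>Consequently the summand \<open>x\<^sub>1\<^sup>g\<close>, once absent from the padding,
  stays absent at all later positions.\<close>

lemma left_lead_Suc:
  assumes "left_lead d p c k" "k < d" "1 \<le> p"
  shows "left_lead d p c (Suc k)"
proof -
  obtain xs where xs: "xs \<in> idx k p" "c (xs @ replicate (d - k) 1) \<noteq> 0"
    using assms(1) by (auto simp: left_lead_def)
  have "replicate (d - k) (1::nat) = 1 # replicate (d - Suc k) 1"
    using assms(2) by (simp flip: replicate_Suc add: Suc_diff_Suc)
  then have "c ((xs @ [1]) @ replicate (d - Suc k) 1) \<noteq> 0" using xs(2) by simp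
  moreover have "xs @ [1] \<in> idx (Suc k) p" using xs(1) assms(3) by (intro idx_snoc) auto
  ultimately show ?thesis unfolding left_lead_def by blast
qed

context
  fixes d p g :: nat and c :: tensor
  assumes p: "p = Suc g" and hom: "homogeneous d p g c" and nz: "nonzero_tensor d p c"
begin

text \<open>A nonzero tensor of degree 0 is never padded. This settles the case
  \<open>p = 1\<close>, in which the two padding monomials coincide.\<close>

lemma lead_if_degree_0:
  assumes "k \<le> d" "g = 0"
  shows "left_lead d p c k" "right_lead d p c k"
proof -
  obtain "is" where i: "is \<in> idx d p" "c is \<noteq> 0" using nz by (auto simp: nonzero_tensor_def)
  then have "is = replicate d 1"
    using hom assms wt_eq_0 by (auto simp: homogeneous_iff)
  then have "c (replicate k 1 @ replicate (d - k) 1) \<noteq> 0"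
    using i(2) assms by (simp flip: replicate_add)
  then show "left_lead d p c k" "right_lead d p c k"
    using idx_replicate[of p] p by (auto simp: left_lead_def right_lead_def)
qed

text \<open>The padding monomials have degree \<open>p - 1\<close>, which is \<open>g\<close> by
  \<open>p = Suc g\<close>.\<close>

lemma homogeneous_pad: "homogeneous d p g (pad d p c k)"
  unfolding homogeneous_iff
proof (intro ballI impI)
  fix "is" assume i: "is \<in> idx d p" "pad d p c k is \<noteq> 0"
  then have "c is \<noteq> 0 \<or> is = p # replicate (d - 1) 1 \<or> is = replicate (d - 1) 1 @ [p]"
    by (auto simp: pad_def split: if_splits)
  then show "wt is = g" using hom i p by (auto simp: homogeneous_iff)
qed

text \<open>If the block of degree \<open>g\<close> was zero, the added coefficient 1 stands alone
  in it; if not, a nonzero entry survives, because the only other possible summand lies outside this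
  block.\<close>

lemma pad_left_lead:
  assumes "1 \<le> k" "k < d"
  shows "left_lead d p (pad d p c k) k"
proof -
  have last: "xs @ replicate (d - k) (1::nat) \<noteq> replicate (d - 1) 1 @ [p]" if "\<not> right_lead d p c k" for xs
  proof
    assume eq: "xs @ replicate (d - k) (1::nat) = replicate (d - 1) 1 @ [p]"
    then have "last (xs @ replicate (d - k) (1::nat)) = last (replicate (d - 1) 1 @ [p])" by simp
    then have "p = 1" using assms by simp
    then show False using that lead_if_degree_0(2)[of k] p assms by simp
  qed
  show ?thesis
  proof (cases "left_lead d p c k")
    case True
    then obtain xs where xs: "xs \<in> idx k p" "c (xs @ replicate (d - k) 1) \<noteq> 0"
      by (auto simp: left_lead_def)
    then have "pad d p c k (xs @ replicate (d - k) 1) \<noteq> 0"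
      using True last[of xs] assms by (auto simp: pad_def)
    then show ?thesis using xs(1) by (auto simp: left_lead_def)
  next
    case False
    let ?xs = "p # replicate (k - 1) 1"
    have xs: "?xs \<in> idx k p"
      using idx_Cons[of p p "replicate (k - 1) 1" "k - 1"] idx_replicate[of p "k - 1"] p assms by simp
    have "c (?xs @ replicate (d - k) 1) = 0" using False xs unfolding left_lead_def by blast
    moreover have "?xs @ replicate (d - k) 1 = p # replicate (d - 1) 1"
      using assms by (simp flip: replicate_add)
    ultimately have "pad d p c k (?xs @ replicate (d - k) 1) \<noteq> 0"
      using False assms last[of ?xs] by (auto simp: pad_def)
    then show ?thesis using xs unfolding left_lead_def by blast
  qed
qed

end

lemma pad_right_lead:
  assumes "p = Suc g" "homogeneous d p g c" "nonzero_tensor d p c" "1 \<le> k" "k < d"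
  shows "right_lead d p (pad d p c k) k"
proof -
  have "nonzero_tensor d p (\<lambda>is. c (rev is))"
    using assms(3) unfolding nonzero_tensor_def by (metis idx_rev rev_rev_ident)
  then have "left_lead d p (pad d p (\<lambda>is. c (rev is)) (d - k)) (d - k)"
    using assms by (intro pad_left_lead) (auto simp: homogeneous_rev)
  then show ?thesis using assms left_lead_rev[of "d - k" d p "pad d p c k"]
    by (simp add: pad_rev left_lead_def)
qed

text \<open>From \<open>k\<close> to \<open>Suc k\<close> the tensor changes at most by multiples of
  the two padding monomials, so it suffices that their columns lie in the column space at
  \<open>k\<close>. For \<open>x\<^sub>d\<^sup>g\<close> this always holds; for
  \<open>x\<^sub>1\<^sup>g\<close> it is needed only where that monomial is present at
  \<open>k\<close>.\<close>

lemma nested_pad: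
  assumes p: "p = Suc g" and hom: "homogeneous d p g c" and nz: "nonzero_tensor d p c"
  shows "nested d p (pad d p c)"
  unfolding nested_def
proof (intro allI impI)
  fix k assume k: "1 \<le> k" "k < d"
  define e where "e = pad d p c k"
  define sp where "sp v \<longleftrightarrow> (\<exists>t. \<forall>xs\<in>idx k p. v xs = (\<Sum>ys\<in>idx (d - k) p. e (xs @ ys) * t ys))" for v :: tensor
  have slice: "sp v" if "ys \<in> idx (d - k) p" "\<And>xs. xs \<in> idx k p \<Longrightarrow> v xs = e (xs @ ys) * a" for v ys a
    unfolding sp_def
  proof (intro exI ballI)
    fix xs assume "xs \<in> idx k p"
    then have "v xs = e (xs @ ys) * a" by (rule that(2))
    also have "\<dots> = (\<Sum>zs\<in>idx (d - k) p. if zs = ys then e (xs @ zs) * a else 0)"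
      using that(1) by simp
    also have "\<dots> = (\<Sum>zs\<in>idx (d - k) p. e (xs @ zs) * (if zs = ys then a else 0))"
      by (intro sum.cong refl) simp
    finally show "v xs = (\<Sum>zs\<in>idx (d - k) p. e (xs @ zs) * (if zs = ys then a else 0))" .
  qed
  have add: "sp (\<lambda>xs. v xs + a * w xs)" if v: "sp v" and w: "sp w" for v w a
  proof -
    obtain s t where s: "\<forall>xs\<in>idx k p. v xs = (\<Sum>ys\<in>idx (d - k) p. e (xs @ ys) * s ys)"
      and t: "\<forall>xs\<in>idx k p. w xs = (\<Sum>ys\<in>idx (d - k) p. e (xs @ ys) * t ys)"
      using v w unfolding sp_def by blast
    then have "\<forall>xs\<in>idx k p. v xs + a * w xs = (\<Sum>ys\<in>idx (d - k) p. e (xs @ ys) * (s ys + a * t ys))"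
      by (simp add: sum_distrib_left sum.distrib[symmetric] algebra_simps)
    then show ?thesis unfolding sp_def by (intro exI)
  qed
  define P where "P zs xs = (of_bool (xs @ zs = p # replicate (d - 1) 1) :: real)" for zs xs
  define Q where "Q zs xs = (of_bool (xs @ zs = replicate (d - 1) 1 @ [p]) :: real)" for zs xs
  \<comment> \<open>Some column has a nonzero entry in the row of the constant monomial. The
    monomial of this column has degree \<open>g\<close>, so its other entries vanish, and a multiple
    of it is \<open>Q zs\<close>.\<close>
  have spQ: "sp (Q zs)" if zs: "zs \<in> idx (d - k) p" for zs
  proof -
    obtain ys where ys: "ys \<in> idx (d - k) p" "e (replicate k 1 @ ys) \<noteq> 0"
      using pad_right_lead[OF p hom nz k] unfolding right_lead_def e_def by blast
    have he: "homogeneous d p g e" unfolding e_def by (rule homogeneous_pad[OF p hom nz])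
    have one: "replicate k 1 \<in> idx k p" using idx_replicate[of p k] p by simp
    have wy: "wt ys = g"
      using he idx_append_le[OF less_imp_le[OF k(2)] one ys(1)] ys(2)
      by (auto simp: homogeneous_iff)
    have dk: "replicate (d - 1) (1::nat) @ [p] = replicate k 1 @ (replicate (d - 1 - k) 1 @ [p])"
      using k by (simp flip: replicate_add append_assoc)
    show ?thesis
    proof (rule slice[OF ys(1), where a = "of_bool (zs = replicate (d - 1 - k) 1 @ [p]) / e (replicate k 1 @ ys)"])
      fix xs assume xs: "xs \<in> idx k p"
      have Q: "Q zs xs = of_bool (xs = replicate k 1 \<and> zs = replicate (d - 1 - k) 1 @ [p])"
        unfolding Q_def dk using length_idx[OF xs] by (subst append_eq_append_conv) auto
      show "Q zs xs = e (xs @ ys) * (of_bool (zs = replicate (d - 1 - k) 1 @ [p]) / e (replicate k 1 @ ys))"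
      proof (cases "xs = replicate k 1")
        case True
        then show ?thesis using ys(2) Q by simp
      next
        case False
        then have "wt xs \<noteq> 0" using wt_eq_0[OF xs] by auto
        then have "e (xs @ ys) = 0"
          using he idx_append_le[OF less_imp_le[OF k(2)] xs ys(1)] wy by (auto simp: homogeneous_iff)
        then show ?thesis using Q False by simp
      qed
    qed
  qed
  \<comment> \<open>As \<open>c\<close> has no monomial in the first \<open>k\<close> variables
    alone, the column of \<open>e\<close> at the constant monomial consists of the padding
    only.\<close>
  have spP: "sp (P zs)" if zs: "zs \<in> idx (d - k) p" and nl: "\<not> left_lead d p c k" for zs
  proof (rule slice[where a = "of_bool (zs = replicate (d - k) 1)"])
    show "replicate (d - k) 1 \<in> idx (d - k) p" using idx_replicate[of p] p by simp
    fix xs assume xs: "xs \<in> idx k p"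
    have g: "g \<noteq> 0" using nl lead_if_degree_0(1)[OF p hom nz, of k] k by auto
    have "last (xs @ replicate (d - k) (1::nat)) = 1" using k by simp
    then have "xs @ replicate (d - k) 1 \<noteq> replicate (d - 1) 1 @ [p]" using p g by auto
    moreover have "c (xs @ replicate (d - k) 1) = 0" using nl xs unfolding left_lead_def by blast
    ultimately have e: "e (xs @ replicate (d - k) 1) = P (replicate (d - k) 1) xs"
      using nl k by (simp add: e_def pad_def P_def)
    have dk: "p # replicate (d - 1) 1 = (p # replicate (k - 1) 1) @ replicate (d - k) 1"
      using k by (simp flip: replicate_add)
    have P: "P ws xs = of_bool (xs = p # replicate (k - 1) 1 \<and> ws = replicate (d - k) 1)" for ws
      unfolding P_def dk using length_idx[OF xs] k by (subst append_eq_append_conv) auto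
    show "P zs xs = e (xs @ replicate (d - k) 1) * of_bool (zs = replicate (d - k) 1)"
      unfolding e P by simp
  qed
  have "\<exists>t. \<forall>xs\<in>idx k p. pad d p c (Suc k) (xs @ zs) = (\<Sum>ys\<in>idx (d - k) p. e (xs @ ys) * t ys)"
    if zs: "zs \<in> idx (d - k) p" for zs
  proof -
    define \<alpha> \<beta> where "\<alpha> = (of_bool (\<not> left_lead d p c k) :: real)"
      and "\<beta> = (of_bool (\<not> right_lead d p c k) :: real)"
    \<comment> \<open>The condition \<open>Suc k < d\<close> accounts for the last position, where
      \<open>pad\<close> is \<open>c\<close> itself.\<close>
    define \<alpha>' \<beta>' where "\<alpha>' = (of_bool (Suc k < d \<and> \<not> left_lead d p c (Suc k)) :: real)"
      and "\<beta>' = (of_bool (Suc k < d \<and> \<not> right_lead d p c (Suc k)) :: real)"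
    have "pad d p c (Suc k) (xs @ zs) = (e (xs @ zs) + (\<alpha>' - \<alpha>) * P zs xs) + (\<beta>' - \<beta>) * Q zs xs" for xs
      using k by (auto simp: e_def pad_def \<alpha>_def \<alpha>'_def \<beta>_def \<beta>'_def P_def Q_def)
    moreover have "sp (\<lambda>xs. (e (xs @ zs) + (\<alpha>' - \<alpha>) * P zs xs) + (\<beta>' - \<beta>) * Q zs xs)"
    proof (rule add[OF _ spQ[OF zs]])
      have ez: "sp (\<lambda>xs. e (xs @ zs))" by (rule slice[OF zs, where a = 1]) simp
      show "sp (\<lambda>xs. e (xs @ zs) + (\<alpha>' - \<alpha>) * P zs xs)"
      proof (cases "left_lead d p c k")
        case True
        then have "\<alpha>' - \<alpha> = 0"
          using left_lead_Suc[of d p c k] k p by (simp add: \<alpha>_def \<alpha>'_def)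
        then show ?thesis using ez by simp
      next
        case False
        then show ?thesis by (intro add ez spP zs)
      qed
    qed
    ultimately show ?thesis by (simp add: sp_def)
  qed
  then have "\<forall>zs. \<exists>t. zs \<in> idx (d - k) p \<longrightarrow> (\<forall>xs\<in>idx k p.
      pad d p c (Suc k) (xs @ zs) = (\<Sum>ys\<in>idx (d - k) p. e (xs @ ys) * t ys))"
    by blast
  then obtain T where "\<forall>zs. zs \<in> idx (d - k) p \<longrightarrow> (\<forall>xs\<in>idx k p.
      pad d p c (Suc k) (xs @ zs) = (\<Sum>ys\<in>idx (d - k) p. e (xs @ ys) * T zs ys))"
    unfolding choice_iff by (elim exE)
  then show "\<exists>T. \<forall>xs\<in>idx k p. \<forall>zs\<in>idx (d - k) p.
      pad d p c (Suc k) (xs @ zs) = (\<Sum>ys\<in>idx (d - k) p. pad d p c k (xs @ ys) * T ys zs)"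
    unfolding e_def by (intro exI[of _ "\<lambda>ys zs. T zs ys"]) blast
qed

lemma nested_pad_rev:
  assumes p: "p = Suc g" and hom: "homogeneous d p g c" and nz: "nonzero_tensor d p c"
  shows "nested d p (\<lambda>k is. pad d p c (d - k) (rev is))"
proof -
  have "nonzero_tensor d p (\<lambda>is. c (rev is))"
    using nz unfolding nonzero_tensor_def by (metis idx_rev rev_rev_ident)
  then have "nested d p (pad d p (\<lambda>is. c (rev is)))"
    using p hom by (intro nested_pad) (auto simp: homogeneous_rev)
  then show ?thesis unfolding nested_def by (simp add: pad_rev)
qed

text \<open>Every column is its own expansion. The constant family yields ranks equal to the sums of
  the block ranks of \<open>c\<close>, against which minimal ranks are compared.\<close>

lemma nested_const: "nested d p (\<lambda>_. c)"
  unfolding nested_def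
proof (intro allI impI exI ballI)
  fix k xs zs assume "zs \<in> idx (d - k) p"
  then have "c (xs @ zs) = (\<Sum>ys\<in>idx (d - k) p. if ys = zs then c (xs @ ys) else 0)" by simp
  also have "\<dots> = (\<Sum>ys\<in>idx (d - k) p. c (xs @ ys) * (if ys = zs then 1 else 0))"
    by (intro sum.cong refl) simp
  finally show "c (xs @ zs) = (\<Sum>ys\<in>idx (d - k) p. c (xs @ ys) * (if ys = zs then 1 else 0))" .
qed


section \<open>Variable locality\<close>

text \<open>Such a monomial is determined by its first exponents, a list with sum \<open>h\<close>;
  these lists are counted by stars and bars.\<close>

lemma card_first_variables:
  "card {ys\<in>hom_idx m p h. \<forall>j<m. ys ! j \<noteq> 1 \<longrightarrow> j < n} \<le> (h + n - 1) choose h"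
proof -
  let ?B = "{ys\<in>hom_idx m p h. \<forall>j<m. ys ! j \<noteq> 1 \<longrightarrow> j < n}"
  let ?f = "\<lambda>ys. map (\<lambda>i. i - 1) (take n ys)"
  \<comment> \<open>If \<open>n\<close> exceeds the number \<open>m\<close> of variables, only
    \<open>m\<close> exponents exist, hence the minimum.\<close>
  let ?L = "{l::nat list. length l = min m n \<and> sum_list l = h}"
  have ge1: "1 \<le> ys ! j" if "ys \<in> ?B" "j < m" for ys j
    using that by (auto simp: hom_idx_def idx_def subset_iff)
  have "?L \<subseteq> {l. set l \<subseteq> {..h} \<and> length l = min m n}"
    using member_le_sum_list by fastforce
  then have fin: "finite ?L"
    by (rule finite_subset) (rule finite_lists_length_eq, simp)
  have "inj_on ?f ?B"
  proof (rule inj_onI)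
    fix ys zs assume ys: "ys \<in> ?B" and zs: "zs \<in> ?B" and eq: "?f ys = ?f zs"
    have len: "length ys = m" "length zs = m" using ys zs by (auto simp: hom_idx_def idx_def)
    show "ys = zs"
    proof (rule nth_equalityI)
      fix j assume "j < length ys"
      then have j: "j < m" using len by simp
      show "ys ! j = zs ! j"
      proof (cases "j < n")
        case True
        have "?f ys ! j = ?f zs ! j" using eq by simp
        then have "ys ! j - 1 = zs ! j - 1" using True j len by simp
        then show ?thesis using ge1[OF ys j] ge1[OF zs j] by simp
      next
        case False
        then show ?thesis using ys zs j by auto
      qed
    qed (simp add: len)
  qed
  moreover have "?f ` ?B \<subseteq> ?L"
  proof
    fix l assume "l \<in> ?f ` ?B"
    then obtain ys where ys: "ys \<in> ?B" and l: "l = ?f ys" by blast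
    have len: "length ys = m" using ys by (auto simp: hom_idx_def idx_def)
    have "\<forall>x\<in>set (drop n ys). x = Suc 0"
    proof
      fix x assume "x \<in> set (drop n ys)"
      then obtain j where "j < length (drop n ys)" "drop n ys ! j = x" by (auto simp: in_set_conv_nth)
      then have "n + j < m" "x = ys ! (n + j)" using len by auto
      moreover have "\<forall>j<m. ys ! j \<noteq> 1 \<longrightarrow> j < n" using ys by blast
      ultimately show "x = Suc 0" by fastforce
    qed
    then have "drop n ys = replicate (m - n) (Suc 0)"
      using len by (intro replicate_eqI) auto
    then have "wt (drop n ys) = 0" by simp
    moreover have "wt ys = wt (take n ys) + wt (drop n ys)"
      by (simp flip: wt_simps(3))
    ultimately have "wt (take n ys) = h" using ys by (simp add: hom_idx_def)
    then show "l \<in> ?L" using len by (simp add: l wt_def min.commute)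
  qed
  ultimately have "card ?B \<le> card ?L" using fin by (rule card_inj_on_le)
  also have "\<dots> = (h + min m n - 1) choose h"
    by (rule card_length_sum_list)
  also have "\<dots> \<le> (h + n - 1) choose h"
    by (rule binomial_right_mono) simp
  finally show ?thesis .
qed

lemma card_last_variables:
  "card {xs\<in>hom_idx m p h. \<forall>i<m. xs ! i \<noteq> 1 \<longrightarrow> m - n \<le> i} \<le> (h + n - 1) choose h"
proof -
  let ?A = "{xs\<in>hom_idx m p h. \<forall>i<m. xs ! i \<noteq> 1 \<longrightarrow> m - n \<le> i}"
  let ?B = "{ys\<in>hom_idx m p h. \<forall>j<m. ys ! j \<noteq> 1 \<longrightarrow> j < n}"
  have "rev xs \<in> ?B" if xs: "xs \<in> ?A" for xs
  proof -
    have len: "length xs = m" using xs by (simp add: hom_idx_def idx_def)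
    have "j < n" if "j < m" "rev xs ! j \<noteq> 1" for j
    proof -
      have "xs ! (m - Suc j) \<noteq> 1" "m - Suc j < m" using that len by (auto simp: rev_nth)
      then have "m - n \<le> m - Suc j" using xs by blast
      then show ?thesis using that by linarith
    qed
    then show ?thesis using xs by (simp add: hom_idx_def)
  qed
  then have "card ?A \<le> card ?B"
    by (intro card_inj_on_le[of rev]) (auto simp: inj_on_def)
  also have "\<dots> \<le> (h + n - 1) choose h" by (rule card_first_variables)
  finally show ?thesis .
qed

text \<open>The summand for \<open>w\<close> counts the monomials of degree \<open>h\<close> in
  \<open>w\<close> variables that contain the \<open>w\<close>-th one, so the sum sorts monomials by
  their greatest variable. The induction step is Pascal's rule.\<close>

lemma hockey_stick:
  assumes "1 \<le> h"
  shows "(h + n - 1) choose h = (\<Sum>w=1..n. (w + h - 2) choose (w - 1))"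
proof (induction n)
  case 0
  then show ?case using assms by simp
next
  case (Suc n)
  obtain h' where h: "h = Suc h'" using assms by (cases h) auto
  have "(h + Suc n - 1) choose h = ((h' + n) choose h') + ((h + n - 1) choose h)"
    by (simp add: h)
  also have "(h' + n) choose h' = (n + h') choose n"
    using binomial_symmetric[of h' "h' + n"] by (simp add: add.commute)
  finally show ?case using Suc by (simp add: h)
qed

text \<open>After reflection the lower index is the constant \<open>h - 1\<close>, and only the
  upper one grows.\<close>

lemma window_binomial_mono:
  fixes v w h :: nat
  assumes "1 \<le> h" "1 \<le> v" "v \<le> w"
  shows "(v + h - 2) choose (v - 1) \<le> (w + h - 2) choose (w - 1)"
proof -
  have sym: "(u + h - 2) choose (u - 1) = (u + h - 2) choose (h - 1)" if "1 \<le> u" for u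
    using binomial_symmetric[of "u - 1" "u + h - 2"] that assms(1) by (simp add: Suc_diff_le)
  show ?thesis
    using assms by (simp only: sym) (intro binomial_right_mono, simp)
qed

section \<open>Covering the staircase of a block\<close>

text \<open>Locality as a condition on the support. The inequality is one-sided because
  \<open>i\<close> and \<open>j\<close> range over all ordered pairs.\<close>

definition local_tensor :: "nat \<Rightarrow> nat \<Rightarrow> nat \<Rightarrow> tensor \<Rightarrow> bool" where
  "local_tensor d p K e \<longleftrightarrow> (\<forall>is\<in>idx d p. e is \<noteq> 0 \<longrightarrow>
     (\<forall>i<d. \<forall>j<d. is ! i \<noteq> 1 \<longrightarrow> is ! j \<noteq> 1 \<longrightarrow> j \<le> i + K))"

text \<open>\<open>F l\<close> bounds the number of rows with least variable
  \<open>k - K + l\<close>, and \<open>G l\<close> that of columns with greatest variable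
  \<open>k + l\<close>. As \<open>F\<close> falls and \<open>G\<close> rises, one threshold
  \<open>t\<close> realizes all minima at once.\<close>

lemma block_rank_le_locality_bound:
  assumes loc: "local_tensor d p K e" and k: "k \<le> d" and h: "1 \<le> h" "h < g"
  shows "block_rank d p g e k h \<le> locality_bound K g h"
proof -
  define F where "F l = ((K - l + 1 + h - 2) choose (K - l))" for l
  define G where "G l = ((l + g - h - 2) choose (l - 1))" for l
  have F: "F l = ((Suc K - l) + h - 2) choose ((Suc K - l) - 1)" if "l \<le> K" for l
    using that by (simp add: F_def Suc_diff_le)
  have G: "G l = (l + (g - h) - 2) choose (l - 1)" for l
    using h by (simp add: G_def)
  have Fmono: "F l' \<le> F l" if "l \<le> l'" "l' \<le> K" for l l'
    using window_binomial_mono[of h "Suc K - l'" "Suc K - l"] h that by (simp add: F)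
  have Gmono: "G l \<le> G l'" if "1 \<le> l" "l \<le> l'" for l l'
    unfolding G using h that by (intro window_binomial_mono) auto
  \<comment> \<open>The greatest \<open>l\<close> at which columns cost no more than rows. Admitting
    0 keeps the set nonempty; \<open>t = 0\<close> means a cover by rows alone.\<close>
  define t where "t = Max {l\<in>{0..K}. l = 0 \<or> G l \<le> F l}"
  have t: "t \<in> {l\<in>{0..K}. l = 0 \<or> G l \<le> F l}"
    unfolding t_def by (intro Max_in) auto
  have tmax: "l \<le> t" if "l \<in> {0..K}" "G l \<le> F l" for l
    unfolding t_def using that by (intro Max_ge) auto
  have tK: "t \<le> K" using t by simp
  have low: "min (F l) (G l) = G l" if "l \<in> {1..t}" for l
  proof -
    have "G l \<le> G t" "G t \<le> F t" "F t \<le> F l" using that t tK by (auto intro: Gmono Fmono)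
    then show ?thesis by simp
  qed
  have high: "min (F l) (G l) = F l" if "l \<in> {Suc t..K}" for l
    using tmax[of l] that by fastforce
  \<comment> \<open>Positions count from 0: \<open>?A\<close> has the monomials in the last
    \<open>K - t\<close> left variables, \<open>?B\<close> those in the first \<open>t\<close> right
    variables.\<close>
  let ?A = "{xs\<in>hom_idx k p h. \<forall>i<k. xs ! i \<noteq> 1 \<longrightarrow> k - (K - t) \<le> i}"
  let ?B = "{ys\<in>hom_idx (d - k) p (g - h). \<forall>j<d - k. ys ! j \<noteq> 1 \<longrightarrow> j < t}"
  have "block_rank d p g e k h \<le> card ?A + card ?B"
    unfolding block_rank_def
  proof (rule mrank_le_cover)
    fix xs ys assume xs: "xs \<in> hom_idx k p h" and ys: "ys \<in> hom_idx (d - k) p (g - h)"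
      and nz: "e (xs @ ys) \<noteq> 0"
    have len: "length xs = k" "length ys = d - k" and xy: "xs @ ys \<in> idx d p"
      using xs ys k idx_append_le[OF k] by (auto simp: hom_idx_def length_idx)
    \<comment> \<open>A row outside \<open>?A\<close> has a variable at some
      \<open>i < k - (K - t)\<close>, and locality gives
      \<open>k + j \<le> i + K < k + t\<close>.\<close>
    have "j < t" if i: "i < k" "xs ! i \<noteq> 1" "i < k - (K - t)" and j: "j < d - k" "ys ! j \<noteq> 1" for i j
    proof -
      have "(xs @ ys) ! i \<noteq> 1" "(xs @ ys) ! (k + j) \<noteq> 1" using i j len by (simp_all add: nth_append)
      then have "k + j \<le> i + K"
        using loc xy nz i j k unfolding local_tensor_def
        by (metis (no_types, lifting) add.commute less_diff_conv order_less_le_trans)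
      then show ?thesis using i tK by linarith
    qed
    note bound = this
    show "xs \<in> ?A \<or> ys \<in> ?B"
    proof (rule disjCI)
      assume "ys \<notin> ?B"
      then obtain j where "j < d - k" "ys ! j \<noteq> 1" "\<not> j < t" using ys by blast
      then have "k - (K - t) \<le> i" if "i < k" "xs ! i \<noteq> 1" for i
        using bound[OF that, of j] by (meson not_le)
      then show "xs \<in> ?A" using xs by blast
    qed
  qed (simp_all add: finite_subset[OF _ finite_hom_idx])
  also have "card ?A \<le> (h + (K - t) - 1) choose h" by (rule card_last_variables)
  also have "\<dots> = (\<Sum>w=1..K - t. (w + h - 2) choose (w - 1))" using h by (intro hockey_stick) simp
  \<comment> \<open>A window of \<open>w\<close> variables ending at \<open>k\<close> starts at
    \<open>k - K + l\<close> with \<open>l = K + 1 - w\<close>.\<close>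
  also have "\<dots> = (\<Sum>l=Suc t..K. F l)"
    by (rule sum.reindex_bij_witness[where i = "\<lambda>l. Suc K - l" and j = "\<lambda>w. Suc K - w"]) (auto simp: F)
  also have "card ?B \<le> ((g - h) + t - 1) choose (g - h)" by (rule card_first_variables)
  also have "\<dots> = (\<Sum>l=1..t. G l)" unfolding G using h by (intro hockey_stick) simp
  also have "(\<Sum>l=Suc t..K. F l) + (\<Sum>l=1..t. G l) = (\<Sum>l=1..K. min (F l) (G l))"
  proof -
    have "{1..K} = {Suc t..K} \<union> {1..t}" using tK by auto
    then have "(\<Sum>l=1..K. min (F l) (G l)) = (\<Sum>l=Suc t..K. min (F l) (G l)) + (\<Sum>l=1..t. min (F l) (G l))"
      by (simp only:) (intro sum.union_disjoint, auto)
    then show ?thesis using low high by simp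
  qed
  also have "\<dots> = locality_bound K g h"
    by (simp add: locality_bound_def F_def G_def)
  finally show ?thesis by simp
qed

lemma count_list_concat_replicate:
  "distinct ks \<Longrightarrow> count_list (concat (map (\<lambda>k. replicate (f k) k) ks)) x = (if x \<in> set ks then f x else 0)"
proof (induction ks)
  case (Cons k ks)
  have "count_list (replicate n k) x = (if x = k then n else 0)" for n by (induction n) auto
  then show ?case using Cons by auto
qed simp

lemma multinomial_nonzero: "multinomial as \<noteq> 0"
  by (simp add: multinomial_def)

text \<open>For \<open>c is \<noteq> 0\<close> the list \<open>ls\<close> names each variable as
  often as it occurs in the monomial. Its multi-index is \<open>is\<close> again, so its symmetric
  coefficient is nonzero and the locality condition applies to its variables.\<close>

lemma local_if_variable_locality:
  assumes hom: "homogeneous d p g c" and loc: "variable_locality d g K c"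
  shows "local_tensor d p K c"
  unfolding local_tensor_def
proof (intro ballI allI impI)
  fix "is" i j assume i: "is \<in> idx d p" "c is \<noteq> 0"
    and ij: "i < d" "j < d" "is ! i \<noteq> 1" "is ! j \<noteq> 1"
  have len: "length is = d" using i by (simp add: idx_def)
  have ge1: "1 \<le> is ! q" if "q < d" for q
    using i(1) that by (auto simp: idx_def subset_iff)
  define f where "f k = is ! (k - 1) - 1" for k
  define ls where "ls = concat (map (\<lambda>k. replicate (f k) k) [1..<Suc d])"
  have cnt: "count_list ls k = (if k \<in> {1..d} then f k else 0)" for k
    unfolding ls_def by (subst count_list_concat_replicate) auto
  have map_f: "map f [1..<Suc d] = map (\<lambda>m. m - 1) is"
    by (rule nth_equalityI) (simp_all add: len f_def del: upt_Suc)
  have "length ls = sum_list (map f [1..<Suc d])"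
    by (simp add: ls_def length_concat comp_def del: upt_Suc)
  also have "\<dots> = wt is" unfolding map_f wt_def ..
  also have "\<dots> = g" using hom i by (simp add: homogeneous_iff)
  finally have lg: "length ls = g" .
  have "set ls \<subseteq> {1..d}" by (auto simp: ls_def simp del: upt_Suc)
  then have ls: "ls \<in> idx g d" using lg by (simp add: idx_def)
  have mi: "mult_index d ls = is"
    unfolding mult_index_def
  proof (rule nth_equalityI)
    fix q assume "q < length (map (\<lambda>k. 1 + count_list ls k) [1..<Suc d])"
    then show "map (\<lambda>k. 1 + count_list ls k) [1..<Suc d] ! q = is ! q"
      using ge1[of q] by (simp add: cnt f_def del: upt_Suc)
  qed (simp add: len)
  then have nz: "sym_coeff d c ls \<noteq> 0"
    using i(2) by (simp add: sym_coeff_def multinomial_nonzero)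
  have mem: "Suc q \<in> set ls" if "q < d" "is ! q \<noteq> 1" for q
  proof -
    have "count_list ls (Suc q) \<noteq> 0" using cnt[of "Suc q"] ge1[of q] that by (auto simp: f_def)
    then show ?thesis by (metis count_notin)
  qed
  obtain a b where ab: "a < g" "ls ! a = Suc i" "b < g" "ls ! b = Suc j"
    using mem[of i] mem[of j] ij lg by (auto simp: in_set_conv_nth)
  then have "\<not> \<bar>int (ls ! a) - int (ls ! b)\<bar> > int K"
    using loc ls nz unfolding variable_locality_def by blast
  then show "j \<le> i + K" using ab by simp
qed

text \<open>A power of a single variable is local for every \<open>K\<close>.\<close>

lemma local_pad:
  assumes "local_tensor d p K c"
  shows "local_tensor d p K (pad d p c k)"
  unfolding local_tensor_def
proof (intro ballI allI impI)
  fix "is" i j assume i: "is \<in> idx d p" "pad d p c k is \<noteq> 0"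
    and ij: "i < d" "j < d" "is ! i \<noteq> 1" "is ! j \<noteq> 1"
  have "c is \<noteq> 0 \<or> is = p # replicate (d - 1) 1 \<or> is = replicate (d - 1) 1 @ [p]"
    using i(2) by (auto simp: pad_def split: if_splits)
  then consider "c is \<noteq> 0" | "is = p # replicate (d - 1) 1" | "is = replicate (d - 1) 1 @ [p]"
    by blast
  then show "j \<le> i + K"
  proof cases
    case 1
    then show ?thesis using assms i(1) ij by (simp add: local_tensor_def)
  next
    case 2
    then have "i = 0" "j = 0" using ij by (auto simp: nth_Cons split: nat.splits)
    then show ?thesis by simp
  next
    case 3
    then have "\<not> i < d - 1" "\<not> j < d - 1" using ij by (auto simp: nth_append)
    then show ?thesis using ij by simp
  qed
qed


section \<open>Extreme blocks\<close>

text \<open>The only row is that of the constant monomial, so the rank is 1 or 0 according to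
  whether this row has a nonzero entry; homogeneity gives such an entry degree \<open>g\<close> on
  the right.\<close>

lemma block_rank_0:
  assumes "homogeneous d p g e" "k \<le> d" "1 \<le> p"
  shows "block_rank d p g e k 0 = (if right_lead d p e k then 1 else 0)"
proof -
  have X: "hom_idx k p 0 = {replicate k 1}"
    using wt_eq_0 idx_replicate[OF assms(3)] by (auto simp: hom_idx_def)
  have "block_rank d p g e k 0 \<le> card {replicate k (1::nat)} + card ({} :: nat list set)"
    unfolding block_rank_def X by (rule mrank_le_cover) auto
  moreover have "block_rank d p g e k 0 = 0 \<longleftrightarrow> \<not> right_lead d p e k"
  proof -
    have "wt ys = g" if "ys \<in> idx (d - k) p" "e (replicate k 1 @ ys) \<noteq> 0" for ys
      using assms(1) idx_append_le[OF assms(2) idx_replicate[OF assms(3)] that(1)] that(2)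
      by (auto simp: homogeneous_iff)
    then show ?thesis
      unfolding block_rank_def mrank_eq_0_iff[OF finite_hom_idx] unfolding X right_lead_def
      by (auto simp: hom_idx_def)
  qed
  ultimately show ?thesis by auto
qed

lemma block_rank_g:
  assumes "homogeneous d p g e" "k \<le> d" "1 \<le> p"
  shows "block_rank d p g e k g = (if left_lead d p e k then 1 else 0)"
  using block_rank_0[of d p g "\<lambda>is. e (rev is)" "d - k"] block_rank_rev[of "d - k" d 0 g p e]
    right_lead_rev[of "d - k" d p e] assms
  by (simp add: homogeneous_rev)

lemma nth_eq_replicate_iff:
  "length xs = n \<Longrightarrow> xs = replicate n a \<longleftrightarrow> (\<forall>i<n. xs ! i = a)"
  by (auto simp: list_eq_iff_nth_eq)

lemma has_monomial_in_left:
  assumes "k \<le> d" "1 \<le> p"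
  shows "has_monomial_in d p c {1..k} \<longleftrightarrow> left_lead d p c k"
proof
  assume "has_monomial_in d p c {1..k}"
  then obtain "is" where i: "is \<in> idx d p" "c is \<noteq> 0" "\<forall>q\<in>{1..d}. is ! (q - 1) \<noteq> 1 \<longrightarrow> q \<in> {1..k}"
    by (auto simp: has_monomial_in_def)
  obtain xs ys where xy: "is = xs @ ys" "xs \<in> idx k p" "ys \<in> idx (d - k) p"
    using idx_split[OF i(1) assms(1)] .
  have len: "length xs = k" "length ys = d - k" using xy by (simp_all add: length_idx)
  have "ys ! j = 1" if "j < d - k" for j
  proof -
    have "is ! (Suc (k + j) - 1) = ys ! j" using len by (simp add: xy(1) nth_append)
    moreover have "Suc (k + j) \<in> {1..d}" "Suc (k + j) \<notin> {1..k}" using that by auto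
    ultimately show ?thesis using i(3) by metis
  qed
  then have "ys = replicate (d - k) 1" using len by (simp add: nth_eq_replicate_iff)
  then show "left_lead d p c k" using i(2) xy by (auto simp: left_lead_def)
next
  assume "left_lead d p c k"
  then obtain xs where xs: "xs \<in> idx k p" "c (xs @ replicate (d - k) 1) \<noteq> 0"
    by (auto simp: left_lead_def)
  show "has_monomial_in d p c {1..k}"
    unfolding has_monomial_in_def
  proof (intro bexI conjI ballI impI)
    show "xs @ replicate (d - k) 1 \<in> idx d p"
      using idx_append_le[OF assms(1) xs(1)] idx_replicate[OF assms(2)] by simp
    fix q assume "q \<in> {1..d}" "(xs @ replicate (d - k) 1) ! (q - 1) \<noteq> 1"
    then show "q \<in> {1..k}" using length_idx[OF xs(1)] by (auto simp: nth_append split: if_splits)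
  qed (rule xs(2))
qed

lemma has_monomial_in_right:
  assumes "k \<le> d" "1 \<le> p"
  shows "has_monomial_in d p c {k<..d} \<longleftrightarrow> right_lead d p c k"
proof
  assume "has_monomial_in d p c {k<..d}"
  then obtain "is" where i: "is \<in> idx d p" "c is \<noteq> 0" "\<forall>q\<in>{1..d}. is ! (q - 1) \<noteq> 1 \<longrightarrow> q \<in> {k<..d}"
    by (auto simp: has_monomial_in_def)
  obtain xs ys where xy: "is = xs @ ys" "xs \<in> idx k p" "ys \<in> idx (d - k) p"
    using idx_split[OF i(1) assms(1)] .
  have len: "length xs = k" "length ys = d - k" using xy by (simp_all add: length_idx)
  have "xs ! j = 1" if "j < k" for j
  proof -
    have "is ! (Suc j - 1) = xs ! j" using len that by (simp add: xy(1) nth_append)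
    moreover have "Suc j \<in> {1..d}" "Suc j \<notin> {k<..d}" using that assms(1) by auto
    ultimately show ?thesis using i(3) by metis
  qed
  then have "xs = replicate k 1" using len by (simp add: nth_eq_replicate_iff)
  then show "right_lead d p c k" using i(2) xy by (auto simp: right_lead_def)
next
  assume "right_lead d p c k"
  then obtain ys where ys: "ys \<in> idx (d - k) p" "c (replicate k 1 @ ys) \<noteq> 0"
    by (auto simp: right_lead_def)
  show "has_monomial_in d p c {k<..d}"
    unfolding has_monomial_in_def
  proof (intro bexI conjI ballI impI)
    show "replicate k 1 @ ys \<in> idx d p"
      using idx_append_le[OF assms(1) _ ys(1)] idx_replicate[OF assms(2)] by simp
    fix q assume "q \<in> {1..d}" "(replicate k 1 @ ys) ! (q - 1) \<noteq> 1"
    then show "q \<in> {k<..d}" by (auto simp: nth_append split: if_splits)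
  qed (rule ys(2))
qed


section \<open>Block-sparse representations of minimal rank\<close>

lemma block_sparse_rep_ranks:
  assumes rep: "block_sparse_rep d p g c r CL CR S" and k: "k \<in> {1..<d}"
  shows "h \<le> g \<Longrightarrow> block_rank d p g c k h \<le> card (S k h)"
    and "(\<Sum>h\<le>g. card (S k h)) \<le> r k"
proof -
  have repL: "tt_represents d p r CL c" and orth: "left_orthogonal d p r CL"
    and S: "\<And>h. h \<le> g \<Longrightarrow> S k h = {l\<in>{1..r k}. homogeneous k p h (left_interface CL r k l)}"
    and bs: "block_sparse d p g r S CL" and S0: "\<And>h. h \<le> g \<Longrightarrow> S 0 h = (if h = 0 then {1} else {})"
    using rep k unfolding block_sparse_rep_def by blast+
  have r0: "r 0 = 1" and c: "\<And>is. is \<in> idx d p \<Longrightarrow> c is = tt_segment CL r 0 d 1 1 is"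
    using repL by (auto simp: tt_represents_def)
  have on: "orthonormal (idx k p) {1..r k} (left_interface CL r k)"
    using left_interface_orthonormal[OF orth r0] k by simp
  have fin: "finite (S k h)" if "h \<le> g" for h using S[OF that] by simp
  have "S k h \<inter> S k h' = {}" if "h \<le> g" "h' \<le> g" "h \<noteq> h'" for h h'
  proof -
    have False if "l \<in> S k h" "l \<in> S k h'" for l
    proof -
      have l: "l \<in> {1..r k}" using \<open>h \<le> g\<close> that S by blast
      obtain x where "x \<in> idx k p" "left_interface CL r k l x \<noteq> 0"
        using orthonormal_nonzero[OF on l] .
      then show False using that \<open>h \<le> g\<close> \<open>h' \<le> g\<close> \<open>h \<noteq> h'\<close> by (auto simp: S homogeneous_iff)
    qed
    then show ?thesis by blast
  qed
  then have "(\<Sum>h\<le>g. card (S k h)) = card (\<Union>h\<in>{..g}. S k h)"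
    using fin by (intro card_UN_disjoint[symmetric]) auto
  also have "\<dots> \<le> card {1..r k}"
    using S by (intro card_mono) auto
  finally show "(\<Sum>h\<le>g. card (S k h)) \<le> r k" by simp
  assume h: "h \<le> g"
  \<comment> \<open>The last component of the segment has a nonzero entry ending in
    \<open>l\<close>, so block sparsity puts \<open>l\<close> into some block, and homogeneity
    identifies its degree as that of \<open>xs\<close>.\<close>
  have in_S: "l \<in> S k (wt xs)" if l: "l \<in> {1..r k}" and xs: "xs \<in> idx k p" and nz: "left_interface CL r k l xs \<noteq> 0" for l xs
  proof -
    obtain k' where k': "k = Suc k'" using k by (cases k) auto
    obtain ys i where ys: "xs = ys @ [i]" "ys \<in> idx k' p" "i \<in> {1..p}"
      using xs unfolding k' by (rule idx_SucE)
    have "(\<Sum>j=1..r k'. left_interface CL r k' j ys * CL k j i l) \<noteq> 0"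
      using nz left_interface_snoc[of r ys k' CL l i] r0 length_idx[OF ys(2)] by (simp add: ys(1) k')
    then obtain j where "j \<in> {1..r k'}" "left_interface CL r k' j ys * CL k j i l \<noteq> 0"
      by (rule sum.not_neutral_contains_not_neutral)
    then have "j \<in> {1..r (k - 1)}" "CL k j i l \<noteq> 0" by (auto simp: k')
    moreover have "k \<in> {1..d}" using k by auto
    ultimately obtain h' where h': "h' + (i - 1) \<le> g" "l \<in> S k (h' + (i - 1))"
      using bs ys(3) l unfolding block_sparse_def by blast
    then have "homogeneous k p (h' + (i - 1)) (left_interface CL r k l)" using S by blast
    then have "wt xs = h' + (i - 1)" using xs nz by (simp add: homogeneous_iff)
    then show ?thesis using h'(2) by simp
  qed
  show "block_rank d p g c k h \<le> card (S k h)"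
    unfolding block_rank_def
  proof (rule mrank_le[OF fin[OF h]])
    fix xs ys assume xs: "xs \<in> hom_idx k p h" and ys: "ys \<in> hom_idx (d - k) p (g - h)"
    have xs': "xs \<in> idx k p" "wt xs = h" and ys': "ys \<in> idx (d - k) p" using xs ys by (auto simp: hom_idx_def)
    have "c (xs @ ys) = tt_segment CL r 0 d 1 1 (xs @ ys)"
      using k idx_append_le[OF _ xs'(1) ys'] by (intro c) simp
    also have "\<dots> = (\<Sum>l=1..r k. left_interface CL r k l xs * tt_segment CL r k d l 1 ys)"
      unfolding left_interface_def using k length_idx[OF xs'(1)] length_idx[OF ys']
      by (intro tt_segment_append) auto
    also have "\<dots> = (\<Sum>l\<in>S k h. left_interface CL r k l xs * tt_segment CL r k d l 1 ys)"
    proof (rule sum.mono_neutral_right)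
      show "S k h \<subseteq> {1..r k}" using S[OF h] by blast
      show "\<forall>l\<in>{1..r k} - S k h. left_interface CL r k l xs * tt_segment CL r k d l 1 ys = 0"
      proof
        fix l assume "l \<in> {1..r k} - S k h"
        then have "left_interface CL r k l xs = 0" using in_S[of l xs] xs' by blast
        then show "left_interface CL r k l xs * tt_segment CL r k d l 1 ys = 0" by simp
      qed
    qed simp
    finally show "c (xs @ ys) = (\<Sum>l\<in>S k h. left_interface CL r k l xs * tt_segment CL r k d l 1 ys)" .
  qed
qed

text \<open>By minimality \<open>r k\<close> is at most the sum of the block ranks. These are
  termwise at most \<open>card (S k h)\<close>, whose sum is at most \<open>r k\<close>; hence
  equality holds in every term.\<close>

lemma minimal_block_sizes:
  assumes d: "1 \<le> d" and hom: "homogeneous d p g c"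
    and rank: "tt_rank d p c r" and rep: "block_sparse_rep d p g c r CL CR S"
    and k: "k \<in> {1..<d}" and h: "h \<le> g"
  shows "card (S k h) = block_rank d p g c k h"
proof -
  obtain r' CL' CR' S' where rep': "block_sparse_rep d p g c r' CL' CR' S'"
    and r': "\<forall>k\<in>{1..<d}. r' k = (\<Sum>h\<le>g. block_rank d p g c k h)"
    using block_sparse_rep_exists[of d p g "\<lambda>_. c" c, OF d hom refl refl nested_const nested_const]
    by blast
  have "tt_represents d p r' CL' c" using rep' by (simp add: block_sparse_rep_def)
  then have "r k \<le> r' k" using rank k by (auto simp: tt_rank_def)
  then have "(\<Sum>h\<le>g. card (S k h)) \<le> (\<Sum>h\<le>g. block_rank d p g c k h)"
    using block_sparse_rep_ranks(2)[OF rep k] r' k by simp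
  moreover have le: "block_rank d p g c k h \<le> card (S k h)" if "h \<le> g" for h
    by (rule block_sparse_rep_ranks(1)[OF rep k that])
  ultimately have "(\<Sum>h\<le>g. block_rank d p g c k h) = (\<Sum>h\<le>g. card (S k h))"
    by (intro antisym[OF sum_mono]) simp_all
  then show ?thesis
    using sum_mono_inv[of "block_rank d p g c k" "{..g}" "\<lambda>h. card (S k h)" h] le h by simp
qed

text \<open>The first half uses a padded representation, whose extreme blocks are nonzero at every
  position, possibly at the cost of larger ranks. In the second half minimal ranks force the block
  sizes to be the block ranks of \<open>c\<close>.\<close>

theorem theorem3p4:
  fixes d p g K :: nat and c :: tensor
  assumes "1 \<le> d"
    and "g + 1 = p"
    and "nonzero_tensor d p c"
    and "homogeneous d p g c"
    and "variable_locality d g K c"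
  shows
    "(\<exists>r CL CR S. block_sparse_rep d p g c r CL CR S \<and>
        (\<forall>k\<in>{1..<d}.
           (\<forall>h\<in>{1..<g}. card (S k h) \<le> locality_bound K g h) \<and>
           card (S k 0) = 1 \<and> card (S k g) = 1)) \<and>
     (\<forall>r CL CR S. tt_rank d p c r \<and> block_sparse_rep d p g c r CL CR S \<longrightarrow>
        (\<forall>k\<in>{1..<d}.
           (\<forall>h\<in>{1..<g}. card (S k h) \<le> locality_bound K g h) \<and>
           card (S k 0) = (if has_monomial_in d p c {k<..d} then 1 else 0) \<and>
           card (S k g) = (if has_monomial_in d p c {1..k} then 1 else 0)))"
proof (intro conjI allI impI)
  have p: "p = Suc g" using assms(2) by simp
  note hom = assms(4) and nz = assms(3)
  have loc: "local_tensor d p K c" using assms(4,5) by (rule local_if_variable_locality)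
  have homp: "homogeneous d p g (pad d p c k)" for k by (rule homogeneous_pad[OF p hom nz])
  \<comment> \<open>Padding leaves both ends unchanged, so the left and the right form represent
    \<open>c\<close> itself.\<close>
  have "pad d p c 0 = c" "pad d p c d = c" by (auto simp: pad_def)
  then obtain r CL CR S where rep: "block_sparse_rep d p g c r CL CR S"
    and S: "\<forall>k\<in>{1..<d}. \<forall>h\<le>g. card (S k h) = block_rank d p g (pad d p c k) k h"
    using block_sparse_rep_exists[of d p g "pad d p c" c, OF assms(1) homp _ _
        nested_pad[OF p hom nz] nested_pad_rev[OF p hom nz]]
    by blast
  have "(\<forall>h\<in>{1..<g}. card (S k h) \<le> locality_bound K g h) \<and> card (S k 0) = 1 \<and> card (S k g) = 1"
    if k: "k \<in> {1..<d}" for k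
  proof -
    have "card (S k h) \<le> locality_bound K g h" if "h \<in> {1..<g}" for h
      using S k that block_rank_le_locality_bound[OF local_pad[OF loc], of k h g k] by simp
    moreover have "card (S k 0) = 1"
      using S k p block_rank_0[OF homp, of k k] pad_right_lead[OF p hom nz, of k] by simp
    moreover have "card (S k g) = 1"
      using S k p block_rank_g[OF homp, of k k] pad_left_lead[OF p hom nz, of k] by simp
    ultimately show ?thesis by blast
  qed
  with rep show "\<exists>r CL CR S. block_sparse_rep d p g c r CL CR S \<and>
        (\<forall>k\<in>{1..<d}.
           (\<forall>h\<in>{1..<g}. card (S k h) \<le> locality_bound K g h) \<and>
           card (S k 0) = 1 \<and> card (S k g) = 1)"
    by blast
next
  fix r CL CR S assume "tt_rank d p c r \<and> block_sparse_rep d p g c r CL CR S"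
  then have size: "card (S k h) = block_rank d p g c k h" if "k \<in> {1..<d}" "h \<le> g" for k h
    using minimal_block_sizes[OF assms(1,4)] that by blast
  have p: "1 \<le> p" using assms(2) by simp
  have loc: "local_tensor d p K c" using assms(4,5) by (rule local_if_variable_locality)
  show "\<forall>k\<in>{1..<d}.
           (\<forall>h\<in>{1..<g}. card (S k h) \<le> locality_bound K g h) \<and>
           card (S k 0) = (if has_monomial_in d p c {k<..d} then 1 else 0) \<and>
           card (S k g) = (if has_monomial_in d p c {1..k} then 1 else 0)"
  proof (intro ballI conjI)
    fix k assume k: "k \<in> {1..<d}"
    then have kd: "k \<le> d" by simp
    show "card (S k h) \<le> locality_bound K g h" if "h \<in> {1..<g}" for h
      using size[OF k, of h] block_rank_le_locality_bound[OF loc kd, of h g] that by simp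
    show "card (S k 0) = (if has_monomial_in d p c {k<..d} then 1 else 0)"
      unfolding has_monomial_in_right[OF kd p] using size[OF k, of 0] block_rank_0[OF assms(4) kd p] by simp
    show "card (S k g) = (if has_monomial_in d p c {1..k} then 1 else 0)"
      unfolding has_monomial_in_left[OF kd p] using size[OF k, of g] block_rank_g[OF assms(4) kd p] by simp
  qed
qed

end
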